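(* There exist a reproducing kernel Hilbert space $\mathcal{H}$ of holomorphic functions on the open unit disk $\mathbb{D}\subset\mathbb{C}$ and a linear functional $\Lambda:\mathcal{H}\to\mathbb{C}$ with the following properties: (i) The reproducing kernel $K$ associated to $\mathcal{H}$ is normalized at $0$. (ii) The multiplier algebra $\mathcal{M}$ of $\mathcal{H}$ equals $H^\infty$ and is dense in $\mathcal{H}$. (iii) The linear functional $\Lambda$ satisfies $\Lambda(1)=1$ and $\Lambda(hf)=\Lambda(h)\Lambda(f)$ for all $h\in\mathcal{M}$ and all $f\in\mathcal{H}$. (iv) $\Lambda$ is discontinuous on $\mathcal{H}$.
   Context: A reproducing kernel Hilbert space (RKHS) on a set $X$ is a complex Hilbert space $\mathcal{H}$ of functions $X\to\mathbb{C}$ (with pointwise operations) such that, for each $x\in X$, the evaluation functional $f\mapsto f(x)$ is continuous on $\mathcal{H}$. For $x\in X$ let $k_x\in\mathcal{H}$ be the unique element with $f(x)=\langle f,k_x\rangle$ for all $f\in\mathcal{H}$. The reproducing kernel of $\mathcal{H}$ is $K:X\times X\to\mathbb{C}$, $K(x,y):=k_y(x)=\langle k_y,k_x\rangle$. It is always assumed that $K(x,x)>0$ for all $x\in X$. Here $X=\mathbb{D}$. The kernel $K$ is normalized at $x_0\in X$ if $K(x,x_0)=1$ for all $x\in X$. In that case $\mathcal{H}$ contains the constant functions; $1$ denotes the constant function with value $1$. A multiplier of $\mathcal{H}$ is a function $h:X\to\mathbb{C}$ such that $hf\in\mathcal{H}$ for all $f\in\mathcal{H}$; the multiplier algebra $\mathcal{M}$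 is the set of all multipliers. When $K$ is normalized, $\mathcal{M}\subset\mathcal{H}$, and density of $\mathcal{M}$ refers to the norm of $\mathcal{H}$. $H^\infty$ denotes the algebra of bounded holomorphic functions on $\mathbb{D}$. *)

theory Defs
  imports "HOL-Analysis.Analysis"
begin

text \<open>
  A function \<open>X \<rightarrow> \<complex>\<close> is represented by the function on the ambient type that agrees with it on
  \<open>X\<close> and vanishes off \<open>X\<close>.  With this convention equality of functions on \<open>X\<close> is equality in
  HOL, and pointwise sums, scalar multiples and products stay within the represented functions.
  In particular the constant function 1 on \<open>X\<close> is \<open>indicator X\<close>.

  An inner product is linear in its first argument.  Its values outside the carrier \<open>H\<close> are
  irrelevant.
\<close>

locale function_inner_product_space =
  fixes X :: "'a set"
    and H :: "('a \<Rightarrow> complex) set"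
    and ip :: "('a \<Rightarrow> complex) \<Rightarrow> ('a \<Rightarrow> complex) \<Rightarrow> complex"
  assumes vanishes: "f \<in> H \<Longrightarrow> x \<notin> X \<Longrightarrow> f x = 0"
    and zero_mem: "(\<lambda>x. 0) \<in> H"
    and add_mem: "f \<in> H \<Longrightarrow> g \<in> H \<Longrightarrow> (\<lambda>x. f x + g x) \<in> H"
    and scale_mem: "f \<in> H \<Longrightarrow> (\<lambda>x. c * f x) \<in> H"
    and ip_add_left: "f \<in> H \<Longrightarrow> g \<in> H \<Longrightarrow> k \<in> H \<Longrightarrow> ip (\<lambda>x. f x + g x) k = ip f k + ip g k"
    and ip_scale_left: "f \<in> H \<Longrightarrow> k \<in> H \<Longrightarrow> ip (\<lambda>x. c * f x) k = c * ip f k"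
    and ip_commute: "f \<in> H \<Longrightarrow> g \<in> H \<Longrightarrow> ip g f = cnj (ip f g)"
    and ip_pos: "f \<in> H \<Longrightarrow> f \<noteq> (\<lambda>x. 0) \<Longrightarrow> 0 < Re (ip f f)"

definition ip_norm :: "(('a \<Rightarrow> complex) \<Rightarrow> ('a \<Rightarrow> complex) \<Rightarrow> complex) \<Rightarrow> ('a \<Rightarrow> complex) \<Rightarrow> real"
  where "ip_norm ip f = sqrt (Re (ip f f))"

text \<open>
  The locale \<open>Metric_space\<close> requires nonnegativity and symmetry for all arguments, not only for
  those in the carrier; hence the value 0 when an argument lies outside \<open>H\<close>.
\<close>

definition ip_dist ::
  "('a \<Rightarrow> complex) set \<Rightarrow> (('a \<Rightarrow> complex) \<Rightarrow> ('a \<Rightarrow> complex) \<Rightarrow> complex)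
    \<Rightarrow> ('a \<Rightarrow> complex) \<Rightarrow> ('a \<Rightarrow> complex) \<Rightarrow> real"
  where "ip_dist H ip f g =
    (if f \<in> H \<and> g \<in> H then ip_norm ip (\<lambda>x. f x - g x) else 0)"

abbreviation ip_topology ::
  "('a \<Rightarrow> complex) set \<Rightarrow> (('a \<Rightarrow> complex) \<Rightarrow> ('a \<Rightarrow> complex) \<Rightarrow> complex)
    \<Rightarrow> ('a \<Rightarrow> complex) topology"
  where "ip_topology H ip \<equiv> Metric_space.mtopology H (ip_dist H ip)"

definition kernel_element ::
  "('a \<Rightarrow> complex) set \<Rightarrow> (('a \<Rightarrow> complex) \<Rightarrow> ('a \<Rightarrow> complex) \<Rightarrow> complex)
    \<Rightarrow> 'a \<Rightarrow> 'a \<Rightarrow> complex"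
  where "kernel_element H ip x = (THE k. k \<in> H \<and> (\<forall>f\<in>H. f x = ip f k))"

definition reproducing_kernel ::
  "('a \<Rightarrow> complex) set \<Rightarrow> (('a \<Rightarrow> complex) \<Rightarrow> ('a \<Rightarrow> complex) \<Rightarrow> complex)
    \<Rightarrow> 'a \<Rightarrow> 'a \<Rightarrow> complex"
  where "reproducing_kernel H ip x y = kernel_element H ip y x"

locale rkhs = function_inner_product_space +
  assumes complete: "Metric_space.mcomplete H (ip_dist H ip)"
    and continuous_eval: "x \<in> X \<Longrightarrow> continuous_map (ip_topology H ip) euclidean (\<lambda>f. f x)"
    and kernel_pos: "x \<in> X \<Longrightarrow> reproducing_kernel H ip x x \<in> \<real> \<and> 0 < Re (reproducing_kernel H ip x x)"

definition kernel_normalized_at :: "'a set \<Rightarrow> ('a \<Rightarrow> 'a \<Rightarrow> complex) \<Rightarrow> 'a \<Rightarrow> bool"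
  where "kernel_normalized_at X K x0 \<longleftrightarrow> x0 \<in> X \<and> (\<forall>x\<in>X. K x x0 = 1)"

definition multipliers :: "'a set \<Rightarrow> ('a \<Rightarrow> complex) set \<Rightarrow> ('a \<Rightarrow> complex) set"
  where "multipliers X H =
    {h. (\<forall>x. x \<notin> X \<longrightarrow> h x = 0) \<and> (\<forall>f\<in>H. (\<lambda>x. h x * f x) \<in> H)}"

definition H_infty :: "(complex \<Rightarrow> complex) set"
  where "H_infty =
    {h. (\<forall>z. z \<notin> ball 0 1 \<longrightarrow> h z = 0) \<and> h holomorphic_on ball 0 1 \<and> bounded (h ` ball 0 1)}"

definition linear_functional_on ::
  "('a \<Rightarrow> complex) set \<Rightarrow> (('a \<Rightarrow> complex) \<Rightarrow> complex) \<Rightarrow> bool"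
  where "linear_functional_on H L \<longleftrightarrow>
    (\<forall>f\<in>H. \<forall>g\<in>H. L (\<lambda>x. f x + g x) = L f + L g) \<and>
    (\<forall>c. \<forall>f\<in>H. L (\<lambda>x. c * f x) = c * L f)"

context function_inner_product_space
begin

lemma diff_mem: "f \<in> H \<Longrightarrow> g \<in> H \<Longrightarrow> (\<lambda>x. f x - g x) \<in> H"
  using add_mem[of f "\<lambda>x. -1 * g x"] scale_mem[of g "-1"] by simp

lemma ip_add_right:
  assumes "f \<in> H" "g \<in> H" "k \<in> H"
  shows "ip k (\<lambda>x. f x + g x) = ip k f + ip k g"
proof -
  have "ip k (\<lambda>x. f x + g x) = cnj (ip f k + ip g k)"
    using ip_commute[OF add_mem[OF assms(1,2)] assms(3)] ip_add_left[OF assms] by simp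
  then show ?thesis
    using ip_commute[of f k] ip_commute[of g k] assms by simp
qed

lemma ip_scale_right:
  assumes "f \<in> H" "k \<in> H"
  shows "ip k (\<lambda>x. c * f x) = cnj c * ip k f"
proof -
  have "ip k (\<lambda>x. c * f x) = cnj (c * ip f k)"
    using ip_commute[OF scale_mem[OF assms(1)] assms(2)] ip_scale_left[OF assms] by simp
  then show ?thesis using ip_commute[of f k] assms by simp
qed

lemma ip_zero_left: "f \<in> H \<Longrightarrow> ip (\<lambda>x. 0) f = 0"
  using ip_scale_left[OF zero_mem, of f 0] by simp

lemma ip_nonneg: "f \<in> H \<Longrightarrow> 0 \<le> Re (ip f f)"
  using ip_pos[of f] ip_zero_left[OF zero_mem] by (cases "f = (\<lambda>x. 0)") auto

lemma Re_ip_expand: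
  fixes t :: real
  assumes f: "f \<in> H" and g: "g \<in> H"
  shows "Re (ip (\<lambda>x. f x + of_real t * g x) (\<lambda>x. f x + of_real t * g x))
         = Re (ip f f) + 2 * t * Re (ip f g) + t\<^sup>2 * Re (ip g g)"
proof -
  let ?h = "\<lambda>x. of_real t * g x"
  have h: "?h \<in> H" by (rule scale_mem[OF g])
  have "ip (\<lambda>x. f x + ?h x) (\<lambda>x. f x + ?h x) = ip f f + ip ?h f + (ip f ?h + ip ?h ?h)"
    by (simp add: ip_add_right[OF f h add_mem[OF f h]] ip_add_left[OF f h f] ip_add_left[OF f h h])
  moreover have "ip ?h f = of_real t * cnj (ip f g)"
    using ip_scale_left[OF g f] ip_commute[OF f g] by simp
  moreover have "ip f ?h = of_real t * ip f g"
    using ip_scale_right[OF g f] by simp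
  moreover have "ip ?h ?h = of_real (t\<^sup>2) * ip g g"
    using ip_scale_left[OF g h] ip_scale_right[OF g g] by (simp add: power2_eq_square)
  ultimately show ?thesis by simp
qed

lemma Re_ip_le:
  assumes f: "f \<in> H" and g: "g \<in> H"
  shows "Re (ip f g) \<le> ip_norm ip f * ip_norm ip g"
proof (cases "g = (\<lambda>x. 0)")
  case True
  then show ?thesis
    using ip_commute[OF zero_mem f] ip_zero_left[OF f] ip_zero_left[OF zero_mem]
    by (simp add: ip_norm_def)
next
  case False
  let ?A = "Re (ip f f)" and ?B = "Re (ip f g)" and ?C = "Re (ip g g)"
  have C: "0 < ?C" using ip_pos[OF g False] .
  let ?t = "- ?B / ?C"
  have "0 \<le> ?A + 2 * ?t * ?B + ?t\<^sup>2 * ?C"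
    using ip_nonneg[OF add_mem[OF f scale_mem[OF g, of "of_real ?t"]]]
    unfolding Re_ip_expand[OF f g] .
  also have "\<dots> = ?A - ?B\<^sup>2 / ?C"
    using C by (simp add: power2_eq_square field_simps)
  finally have "?B\<^sup>2 \<le> ?A * ?C" using C by (simp add: field_simps)
  then have "\<bar>?B\<bar> \<le> sqrt (?A * ?C)"
    using real_sqrt_le_mono by fastforce
  then show ?thesis by (simp add: ip_norm_def real_sqrt_mult)
qed

lemma ip_norm_triangle:
  assumes f: "f \<in> H" and g: "g \<in> H"
  shows "ip_norm ip (\<lambda>x. f x + g x) \<le> ip_norm ip f + ip_norm ip g"
proof -
  have "Re (ip (\<lambda>x. f x + g x) (\<lambda>x. f x + g x)) = Re (ip f f) + 2 * Re (ip f g) + Re (ip g g)"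
    using Re_ip_expand[OF f g, of 1] by simp
  also have "\<dots> \<le> (ip_norm ip f + ip_norm ip g)\<^sup>2"
    using Re_ip_le[OF f g] ip_nonneg[OF f] ip_nonneg[OF g]
    by (simp add: power2_sum ip_norm_def)
  finally show ?thesis
    unfolding ip_norm_def[of ip "\<lambda>x. f x + g x"]
    by (rule real_le_lsqrt[rotated]) (simp add: ip_norm_def ip_nonneg f g)
qed

sublocale Metric_space H "ip_dist H ip"
proof
  fix f g
  show "0 \<le> ip_dist H ip f g"
    by (simp add: ip_dist_def ip_norm_def ip_nonneg diff_mem)
  have "Re (ip (\<lambda>x. f x - g x) (\<lambda>x. f x - g x)) = Re (ip (\<lambda>x. g x - f x) (\<lambda>x. g x - f x))"
    if "f \<in> H" "g \<in> H"
    using Re_ip_expand[OF zero_mem diff_mem[OF that(2,1)], of "-1"]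
      ip_zero_left[OF zero_mem] ip_zero_left[OF diff_mem[OF that(2,1)]] by simp
  then show "ip_dist H ip f g = ip_dist H ip g f"
    by (simp add: ip_dist_def ip_norm_def)
next
  fix f g assume f: "f \<in> H" and g: "g \<in> H"
  show "ip_dist H ip f g = 0 \<longleftrightarrow> f = g"
  proof
    assume "ip_dist H ip f g = 0"
    then have "(\<lambda>x. f x - g x) = (\<lambda>x. 0)"
      using ip_pos[OF diff_mem[OF f g]] f g by (force simp: ip_dist_def ip_norm_def)
    then show "f = g" by (simp add: fun_eq_iff)
  qed (simp add: ip_dist_def ip_norm_def ip_zero_left[OF zero_mem])
next
  fix f g k assume f: "f \<in> H" and g: "g \<in> H" and k: "k \<in> H"
  show "ip_dist H ip f k \<le> ip_dist H ip f g + ip_dist H ip g k"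
    using ip_norm_triangle[OF diff_mem[OF f g] diff_mem[OF g k]] f g k
    by (simp add: ip_dist_def)
qed

lemma kernel_element_eqI:
  assumes k: "k \<in> H" and rep: "\<And>f. f \<in> H \<Longrightarrow> f x = ip f k"
  shows "kernel_element H ip x = k"
  unfolding kernel_element_def
proof (rule the_equality)
  show "k \<in> H \<and> (\<forall>f\<in>H. f x = ip f k)" using assms by blast
next
  fix l assume "l \<in> H \<and> (\<forall>f\<in>H. f x = ip f l)"
  then have l: "l \<in> H" and eq: "\<And>f. f \<in> H \<Longrightarrow> ip f l = ip f k"
    using rep by auto
  let ?d = "\<lambda>x. l x - k x"
  have d: "?d \<in> H" by (rule diff_mem[OF l k])
  have "ip ?d l = ip ?d ?d + ip ?d k"
    using ip_add_right[OF d k d] by simp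
  then have "ip ?d ?d = 0" using eq[OF d] by simp
  then have "?d = (\<lambda>x. 0)" using ip_pos[OF d] by force
  then show "l = k" by (simp add: fun_eq_iff)
qed

end

end

theory Submission
  imports Defs "HOL-Complex_Analysis.Complex_Analysis" "HOL-Library.Function_Algebras"
    "HOL-Library.Discrete_Functions" "HOL-Real_Asymp.Real_Asymp"
begin

text \<open>
  Let \<open>H\<close> be the space of power series \<open>\<Sum>a\<^sub>n z^n\<close> with \<open>\<Sum>w\<^sub>n \<bar>a\<^sub>n\<bar>\<^sup>2 < \<infinity>\<close>, where the weights
  decrease subexponentially from \<open>w\<^sub>0 = 1\<close>.  Since the weights decrease, multiplication by the
  coordinate is a contraction, and the multiplier algebra is \<open>H_infty\<close> as for the Hardy space.
  The weights are constant on long blocks, but from one block to the next they drop by factors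
  that tend to 0; hence \<open>z H\<close> is not closed and is strictly smaller than \<open>{f \<in> H. f 0 = 0}\<close>.
  A linear functional on \<open>H\<close> that maps 1 to 1 and vanishes on \<open>z H\<close> satisfies
  \<open>\<Lambda> (h f) = \<Lambda> h * \<Lambda> f\<close> for all multipliers \<open>h\<close> and agrees with the evaluation at 0 on the dense
  subspace \<open>H_infty\<close>.  It is discontinuous as soon as it differs from this evaluation somewhere.
\<close>

section \<open>Taylor coefficients on the unit disk\<close>

text \<open>Reading the coefficients off the formal power series gives access to the uniqueness of
  expansions and to the Cauchy product.\<close>

definition taylor_coeff :: "(complex \<Rightarrow> complex) \<Rightarrow> nat \<Rightarrow> complex"
  where "taylor_coeff f n = fps_nth (fps_expansion f 0) n"

lemma holomorphic_has_fps_expansion: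
  assumes "f holomorphic_on ball 0 1"
  shows "f has_fps_expansion fps_expansion f 0"
  using assms by (rule has_fps_expansion_fps_expansion[rotated 2]) auto

lemma taylor_coeff_sums:
  assumes "f holomorphic_on ball 0 1" "z \<in> ball 0 1"
  shows "(\<lambda>n. taylor_coeff f n * z ^ n) sums f z"
  using holomorphic_power_series[OF assms]
  by (simp add: taylor_coeff_def fps_expansion_def)

text \<open>Convergence on the whole disk forces a positive radius of convergence, so
  \<open>Abs_fps a\<close> is an expansion of \<open>f\<close> at 0, and expansions are unique.
  Coefficients of sums, multiples and shifts are computed this way.\<close>

lemma power_series_taylor_coeff:
  assumes "\<And>z. z \<in> ball 0 1 \<Longrightarrow> (\<lambda>n. a n * z ^ n) sums f z"
  shows "f holomorphic_on ball 0 1" "taylor_coeff f = a"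
proof -
  show "f holomorphic_on ball 0 1"
    by (rule power_series_holomorphic[of 0 1 a]) (use assms in simp)
  have "summable (\<lambda>n. fps_nth (Abs_fps a) n * of_real r ^ n)" if "0 < r" "ereal r < 1" for r
    using assms[of "of_real r"] that by (auto dest: sums_summable)
  then have "fps_conv_radius (Abs_fps a) \<ge> 1"
    unfolding fps_conv_radius_def by (rule conv_radius_geI_ex')
  then have "0 < fps_conv_radius (Abs_fps a)"
    by (rule less_le_trans[rotated]) simp
  moreover have "eventually (\<lambda>z. z \<in> ball 0 1) (nhds (0::complex))"
    by (rule eventually_nhds_in_open) auto
  then have "eventually (\<lambda>z. eval_fps (Abs_fps a) z = f z) (nhds 0)"
    by (rule eventually_mono) (simp add: eval_fps_def sums_unique[OF assms, symmetric])
  ultimately have "f has_fps_expansion Abs_fps a"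
    by (simp add: has_fps_expansion_def)
  then show "taylor_coeff f = a"
    using fps_expansion_eqI[of f "Abs_fps a"] by (auto simp: taylor_coeff_def)
qed

lemma taylor_coeff_add:
  assumes "f holomorphic_on ball 0 1" "g holomorphic_on ball 0 1"
  shows "taylor_coeff (\<lambda>z. f z + g z) n = taylor_coeff f n + taylor_coeff g n"
  using power_series_taylor_coeff(2)[of "\<lambda>n. taylor_coeff f n + taylor_coeff g n" "\<lambda>z. f z + g z"]
    sums_add[OF taylor_coeff_sums[OF assms(1)] taylor_coeff_sums[OF assms(2)]]
  by (simp add: ring_distribs)

lemma taylor_coeff_cmult:
  assumes "f holomorphic_on ball 0 1"
  shows "taylor_coeff (\<lambda>z. c * f z) n = c * taylor_coeff f n"
  using power_series_taylor_coeff(2)[of "\<lambda>n. c * taylor_coeff f n" "\<lambda>z. c * f z"]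
    sums_mult[OF taylor_coeff_sums[OF assms], of _ c]
  by (simp add: mult.assoc)

lemma taylor_coeff_diff:
  assumes "f holomorphic_on ball 0 1" "g holomorphic_on ball 0 1"
  shows "taylor_coeff (\<lambda>z. f z - g z) n = taylor_coeff f n - taylor_coeff g n"
  using taylor_coeff_add[OF assms(1), of "\<lambda>z. -1 * g z" n] taylor_coeff_cmult[OF assms(2), of "-1" n]
    assms(2)
  by (simp add: holomorphic_on_minus)

lemma taylor_coeff_mult:
  assumes "f holomorphic_on ball 0 1" "g holomorphic_on ball 0 1"
  shows "taylor_coeff (\<lambda>z. f z * g z) n = (\<Sum>i=0..n. taylor_coeff f i * taylor_coeff g (n - i))"
  using fps_expansion_eqI[OF has_fps_expansion_mult[OF holomorphic_has_fps_expansion[OF assms(1)]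
        holomorphic_has_fps_expansion[OF assms(2)]]]
  by (simp add: taylor_coeff_def fps_mult_nth)

definition power_sum :: "nat \<Rightarrow> (nat \<Rightarrow> complex) \<Rightarrow> complex \<Rightarrow> complex"
  where "power_sum m a z = (if z \<in> ball 0 1 then \<Sum>n<m. a n * z ^ n else 0)"

lemma
  shows power_sum_holomorphic: "power_sum m a holomorphic_on ball 0 1"
    and taylor_coeff_power_sum: "taylor_coeff (power_sum m a) = (\<lambda>n. if n < m then a n else 0)"
proof -
  have "(\<lambda>n. (if n < m then a n else 0) * z ^ n) sums power_sum m a z" if "z \<in> ball 0 1" for z
    using sums_finite[of "{..<m}" "\<lambda>n. (if n < m then a n else 0) * z ^ n"] that
    by (simp add: power_sum_def)
  then show "power_sum m a holomorphic_on ball 0 1"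
    "taylor_coeff (power_sum m a) = (\<lambda>n. if n < m then a n else 0)"
    by (fact power_series_taylor_coeff)+
qed

section \<open>Fourier analysis on circles inside the disk\<close>

lemma taylor_coeff_integral:
  assumes f: "f holomorphic_on ball 0 1" and r: "0 < r" "r < 1"
  shows "((\<lambda>t. f (of_real r * cis (2 * pi * t)) * cnj (cis (2 * pi * t)) ^ n)
    has_integral taylor_coeff f n * of_real r ^ n) {0..1}"
proof -
  have sub: "cball 0 r \<subseteq> ball 0 1" "ball 0 r \<subseteq> (ball 0 1 :: complex set)" using r by auto
  \<comment> \<open>Cauchy's formula for the \<open>n\<close>-th derivative at 0. The rest rewrites
    it as an integral over the angle; on the unit circle \<open>cnj e\<close> is the inverse of
    \<open>e\<close>, which turns the denominator into a power of \<open>cnj e\<close>.\<close>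
  have "((\<lambda>u. f u / (u - 0) ^ Suc n) has_contour_integral
      ((2 * pi * \<i>) / fact n * (deriv ^^ n) f 0)) (circlepath 0 r)"
    using f r sub by (intro Cauchy_has_contour_integral_higher_derivative_circlepath)
      (auto intro!: holomorphic_on_imp_continuous_on elim: holomorphic_on_subset)
  then have I: "((\<lambda>t. f (of_real r * cis (2 * pi * t)) / (of_real r * cis (2 * pi * t)) ^ Suc n
        * (2 * pi * \<i> * of_real r * cis (2 * pi * t)))
      has_integral (2 * pi * \<i>) / fact n * (deriv ^^ n) f 0) {0..1}"
    unfolding has_contour_integral_def
    by (rule has_integral_spike_finite[of "{}", rotated 2])
       (auto simp only: vector_derivative_circlepath01 empty_iff finite.emptyI Diff_empty atLeastAtMost_iff,
        auto simp: circlepath cis_conv_exp mult_ac)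
  have eq: "of_real r ^ n / (2 * pi * \<i>) * (f (of_real r * e) / (of_real r * e) ^ Suc n * (2 * pi * \<i> * of_real r * e)) = f (of_real r * e) * cnj e ^ n"
    if "norm e = 1" for e :: complex
  proof -
    have "e * cnj e = 1" using that by (simp add: complex_norm_square[symmetric])
    moreover have "e \<noteq> 0" using that by auto
    ultimately have "cnj e = inverse e" by (simp add: inverse_unique)
    show ?thesis unfolding \<open>cnj e = inverse e\<close> using r \<open>e \<noteq> 0\<close>
      by (simp add: divide_simps power_mult_distrib mult_ac)
  qed
  show ?thesis
    using has_integral_mult_right[OF I, of "of_real r ^ n / (2 * pi * \<i>)"]
    unfolding eq[OF norm_cis] by (simp add: taylor_coeff_def fps_expansion_def mult.commute)
qed

text \<open>Orthonormality of the exponentials is Cauchy's formula for the coefficients of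
  \<open>z ^ i\<close>. The circle has radius 1/2 because \<open>taylor_coeff_integral\<close> asks
  for a radius below 1; the factor \<open>2 ^ i\<close> undoes the scaling. Complex conjugation
  exchanges \<open>i\<close> and \<open>j\<close>.\<close>

lemma has_integral_cis_power:
  "((\<lambda>t. cis (2 * pi * t) ^ i * cnj (cis (2 * pi * t)) ^ j) has_integral (if i = j then 1 else 0)) {0..1}"
proof -
  have *: "((\<lambda>t. cis (2 * pi * t) ^ i * cnj (cis (2 * pi * t)) ^ j) has_integral (if i = j then 1 else 0)) {0..1}"
    if "j \<le> i" for i j
  proof -
    have "((\<lambda>t. (of_real (1/2) * cis (2 * pi * t)) ^ i * cnj (cis (2 * pi * t)) ^ j)
      has_integral taylor_coeff (\<lambda>z. z ^ i) j * of_real (1/2) ^ j) {0..1}"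
      by (rule taylor_coeff_integral) (auto intro!: holomorphic_intros)
    moreover have "taylor_coeff (\<lambda>z. z ^ i) = (\<lambda>n. if n = i then 1 else 0)"
    proof (rule power_series_taylor_coeff(2))
      fix z :: complex
      show "(\<lambda>n. (if n = i then 1 else 0) * z ^ n) sums z ^ i"
        using sums_single[of i "\<lambda>n. z ^ n"] by (simp add: if_distrib[of "\<lambda>x. x * _"] cong: if_cong)
    qed
    ultimately have "((\<lambda>t. 2 ^ i * ((of_real (1/2) * cis (2 * pi * t)) ^ i * cnj (cis (2 * pi * t)) ^ j))
      has_integral 2 ^ i * ((if j = i then 1 else 0) * of_real (1/2) ^ j)) {0..1}"
      by (intro has_integral_mult_right) simp
    then show ?thesis
      by (rule has_integral_eq_rhs[OF has_integral_eq, rotated]) (auto simp: power_mult_distrib power_divide)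
  qed
  show ?thesis
  proof (cases "j \<le> i")
    case False
    then show ?thesis
      using has_integral_cnj[THEN iffD2, OF *[of i j]] by (simp add: o_def mult.commute)
  qed (rule *)
qed

lemma trigonometric_Parseval:
  "((\<lambda>t. (cmod (\<Sum>n<m. c n * cis (2 * pi * t) ^ n))\<^sup>2) has_integral (\<Sum>n<m. (cmod (c n))\<^sup>2)) {0..1}"
proof -
  have "((\<lambda>t. \<Sum>i<m. \<Sum>j<m. c i * cnj (c j) * (cis (2 * pi * t) ^ i * cnj (cis (2 * pi * t)) ^ j))
    has_integral (\<Sum>i<m. \<Sum>j<m. c i * cnj (c j) * (if i = j then 1 else 0))) {0..1}"
    by (intro has_integral_sum has_integral_mult_right has_integral_cis_power) auto
  also have "(\<Sum>i<m. \<Sum>j<m. c i * cnj (c j) * (if i = j then 1 else 0)) = of_real (\<Sum>n<m. (cmod (c n))\<^sup>2)"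
    by (simp add: if_distrib complex_norm_square del: of_real_power cong: if_cong)
  also have "(\<lambda>t. \<Sum>i<m. \<Sum>j<m. c i * cnj (c j) * (cis (2 * pi * t) ^ i * cnj (cis (2 * pi * t)) ^ j))
    = (\<lambda>t. of_real ((cmod (\<Sum>n<m. c n * cis (2 * pi * t) ^ n))\<^sup>2))"
    unfolding complex_norm_square by (simp only: cnj_sum complex_cnj_mult complex_cnj_power sum_product mult_ac)
  finally show ?thesis
    by (auto dest!: has_integral_linear[OF _ bounded_linear_Re] simp: o_def simp del: of_real_power of_real_sum)
qed

text \<open>The mean of \<open>(cmod (F t - q t))\<^sup>2\<close> over the circle is nonnegative,
  where \<open>q\<close> is the Taylor polynomial there; expanding the square gives Bessel's
  inequality.\<close>

lemma taylor_coeff_Bessel: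
  assumes f: "f holomorphic_on ball 0 1" and r: "0 < r" "r < 1"
  shows "(\<Sum>n<m. (cmod (taylor_coeff f n))\<^sup>2 * r ^ (2 * n))
     \<le> integral {0..1} (\<lambda>t. (cmod (f (of_real r * cis (2 * pi * t))))\<^sup>2)"
proof -
  define c where "c n = taylor_coeff f n * of_real r ^ n" for n
  define F where "F t = f (of_real r * cis (2 * pi * t))" for t
  define q where "q t = (\<Sum>n<m. c n * cis (2 * pi * t) ^ n)" for t
  let ?S = "\<Sum>n<m. (cmod (c n))\<^sup>2"
  have "continuous_on {0..1} F"
    unfolding F_def
    by (intro continuous_intros continuous_on_compose2[OF holomorphic_on_imp_continuous_on[OF f]])
       (use r in \<open>auto simp: norm_mult\<close>)
  then have "(\<lambda>t. (cmod (F t))\<^sup>2) integrable_on {0..1}"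
    by (intro integrable_continuous_interval continuous_intros)
  then have F: "((\<lambda>t. (cmod (F t))\<^sup>2) has_integral integral {0..1} (\<lambda>t. (cmod (F t))\<^sup>2)) {0..1}"
    by (rule integrable_integral)
  \<comment> \<open>By Cauchy's formula, pairing \<open>F\<close> with \<open>q\<close> picks out
    each \<open>c n\<close>, so the mixed term equals the sum of squares \<open>?S\<close>.\<close>
  have "((\<lambda>t. \<Sum>n<m. cnj (c n) * (F t * cnj (cis (2 * pi * t)) ^ n)) has_integral (\<Sum>n<m. cnj (c n) * c n)) {0..1}"
    unfolding c_def F_def by (intro has_integral_sum has_integral_mult_right taylor_coeff_integral f r) auto
  also have "(\<lambda>t. \<Sum>n<m. cnj (c n) * (F t * cnj (cis (2 * pi * t)) ^ n)) = (\<lambda>t. F t * cnj (q t))"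
    by (simp add: q_def sum_distrib_left mult_ac)
  also have "(\<Sum>n<m. cnj (c n) * c n) = of_real ?S"
    by (simp only: of_real_sum complex_norm_square mult.commute)
  finally have Fq: "((\<lambda>t. Re (F t * cnj (q t))) has_integral ?S) {0..1}"
    by (auto dest!: has_integral_linear[OF _ bounded_linear_Re] simp: o_def simp del: of_real_power of_real_sum)
  have "((\<lambda>t. (cmod (F t))\<^sup>2 - 2 * Re (F t * cnj (q t)) + (cmod (q t))\<^sup>2)
    has_integral integral {0..1} (\<lambda>t. (cmod (F t))\<^sup>2) - 2 * ?S + ?S) {0..1}"
    unfolding q_def
    by (intro has_integral_add has_integral_diff has_integral_mult_right F Fq[unfolded q_def] trigonometric_Parseval)
  moreover have "0 \<le> (cmod (F t))\<^sup>2 - 2 * Re (F t * cnj (q t)) + (cmod (q t))\<^sup>2" for t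
  proof -
    have "(cmod (F t))\<^sup>2 - 2 * Re (F t * cnj (q t)) + (cmod (q t))\<^sup>2 = (cmod (F t - q t))\<^sup>2"
      unfolding cmod_power2 by (simp add: power2_eq_square algebra_simps)
    then show ?thesis by simp
  qed
  ultimately have "0 \<le> integral {0..1} (\<lambda>t. (cmod (F t))\<^sup>2) - 2 * ?S + ?S"
    by (rule has_integral_nonneg)
  moreover have "(cmod (c n))\<^sup>2 = (cmod (taylor_coeff f n))\<^sup>2 * r ^ (2 * n)" for n
    using r by (simp add: c_def norm_mult norm_power power_mult_distrib power_mult mult.commute flip: power_mult)
  ultimately show ?thesis by (simp add: F_def)
qed

lemma power_sum_Parseval:
  assumes r: "0 < r" "r < 1"
  shows "((\<lambda>t. (cmod (power_sum m a (of_real r * cis (2 * pi * t))))\<^sup>2)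
    has_integral (\<Sum>n<m. (cmod (a n))\<^sup>2 * r ^ (2 * n))) {0..1}"
proof -
  have "(cmod (a n * of_real r ^ n))\<^sup>2 = (cmod (a n))\<^sup>2 * r ^ (2 * n)" for n
    using r by (simp add: norm_mult norm_power power_mult_distrib power_mult mult.commute flip: power_mult)
  moreover have "power_sum m a (of_real r * cis (2 * pi * t)) = (\<Sum>n<m. a n * of_real r ^ n * cis (2 * pi * t) ^ n)" for t
    using r by (simp add: power_sum_def norm_mult power_mult_distrib mult.assoc)
  ultimately show ?thesis
    using trigonometric_Parseval[of "\<lambda>n. a n * of_real r ^ n" m] by simp
qed

section \<open>Multiplication by bounded holomorphic functions\<close>

lemma taylor_coeff_mult_truncate:
  assumes h: "h holomorphic_on ball 0 1" and f: "f holomorphic_on ball 0 1" and "n < m"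
  shows "taylor_coeff (\<lambda>z. h z * power_sum m (taylor_coeff f) z) n = taylor_coeff (\<lambda>z. h z * f z) n"
  using assms by (auto simp: taylor_coeff_mult power_sum_holomorphic taylor_coeff_power_sum intro!: sum.cong)

text \<open>
  The first \<open>m\<close> coefficients of \<open>h f\<close> do not change when \<open>f\<close> is truncated to a polynomial of degree
  below \<open>m\<close>, so Parseval's identity on circles is needed for polynomials only.
\<close>

lemma taylor_coeff_bounded_mult:
  assumes h: "h holomorphic_on ball 0 1" and f: "f holomorphic_on ball 0 1"
    and b: "\<And>z. z \<in> ball 0 1 \<Longrightarrow> cmod (h z) \<le> B"
  shows "(\<Sum>n<m. (cmod (taylor_coeff (\<lambda>z. h z * f z) n))\<^sup>2) \<le> B\<^sup>2 * (\<Sum>n<m. (cmod (taylor_coeff f n))\<^sup>2)"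
proof -
  let ?p = "power_sum m (taylor_coeff f)" and ?c = "taylor_coeff (\<lambda>z. h z * f z)"
  have le: "(\<Sum>n<m. (cmod (?c n))\<^sup>2 * r ^ (2 * n)) \<le> B\<^sup>2 * (\<Sum>n<m. (cmod (taylor_coeff f n))\<^sup>2 * r ^ (2 * n))"
    if r: "0 < r" "r < 1" for r :: real
  proof -
    let ?z = "\<lambda>t. of_real r * cis (2 * pi * t)"
    have z: "?z t \<in> ball 0 1" for t using r by (simp add: norm_mult)
    have hol: "(\<lambda>z. h z * ?p z) holomorphic_on ball 0 1"
      by (intro holomorphic_intros h power_sum_holomorphic)
    have "(\<Sum>n<m. (cmod (?c n))\<^sup>2 * r ^ (2 * n))
      = (\<Sum>n<m. (cmod (taylor_coeff (\<lambda>z. h z * ?p z) n))\<^sup>2 * r ^ (2 * n))"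
      by (simp add: taylor_coeff_mult_truncate[OF h f])
    also have "\<dots> \<le> integral {0..1} (\<lambda>t. (cmod (h (?z t) * ?p (?z t)))\<^sup>2)"
      by (rule taylor_coeff_Bessel[OF hol r])
    also have "\<dots> \<le> integral {0..1} (\<lambda>t. B\<^sup>2 * (cmod (?p (?z t)))\<^sup>2)"
    proof (rule integral_le)
      show "(\<lambda>t. (cmod (h (?z t) * ?p (?z t)))\<^sup>2) integrable_on {0..1}"
        by (intro integrable_continuous_interval continuous_intros
            continuous_on_compose2[OF holomorphic_on_imp_continuous_on[OF hol]]) (use z in auto)
      show "(\<lambda>t. B\<^sup>2 * (cmod (?p (?z t)))\<^sup>2) integrable_on {0..1}"
        by (intro integrable_continuous_interval continuous_intros
            continuous_on_compose2[OF holomorphic_on_imp_continuous_on[OF power_sum_holomorphic]]) (use z in auto)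
      show "(cmod (h (?z t) * ?p (?z t)))\<^sup>2 \<le> B\<^sup>2 * (cmod (?p (?z t)))\<^sup>2" for t
        using b[OF z[of t]] by (simp add: norm_mult power_mult_distrib mult_right_mono power_mono)
    qed
    also have "\<dots> = B\<^sup>2 * (\<Sum>n<m. (cmod (taylor_coeff f n))\<^sup>2 * r ^ (2 * n))"
      using has_integral_mult_right[OF power_sum_Parseval[OF r, of m "taylor_coeff f"], of "B\<^sup>2"]
      by (rule integral_unique)
    finally show ?thesis .
  qed
  \<comment> \<open>Both sides of \<open>le\<close> are polynomials in \<open>r\<close>, so the
    estimate survives the limit as \<open>r\<close> tends to 1 from the left.\<close>
  show ?thesis
  proof (rule tendsto_le)
    show "\<forall>\<^sub>F r in at_left 1. (\<Sum>n<m. (cmod (?c n))\<^sup>2 * r ^ (2 * n)) \<le> B\<^sup>2 * (\<Sum>n<m. (cmod (taylor_coeff f n))\<^sup>2 * r ^ (2 * n))"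
      using eventually_at_left_real[OF zero_less_one] by (rule eventually_mono) (auto intro: le)
    have "((\<lambda>r. \<Sum>n<m. (cmod (?c n))\<^sup>2 * r ^ (2 * n)) \<longlongrightarrow> (\<Sum>n<m. (cmod (?c n))\<^sup>2 * 1 ^ (2 * n))) (at_left 1)"
      by (intro tendsto_intros)
    then show "((\<lambda>r. \<Sum>n<m. (cmod (?c n))\<^sup>2 * r ^ (2 * n)) \<longlongrightarrow> (\<Sum>n<m. (cmod (?c n))\<^sup>2)) (at_left 1)"
      by simp
    have "((\<lambda>r. B\<^sup>2 * (\<Sum>n<m. (cmod (taylor_coeff f n))\<^sup>2 * r ^ (2 * n))) \<longlongrightarrow> B\<^sup>2 * (\<Sum>n<m. (cmod (taylor_coeff f n))\<^sup>2 * 1 ^ (2 * n))) (at_left 1)"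
      by (intro tendsto_intros)
    then show "((\<lambda>r. B\<^sup>2 * (\<Sum>n<m. (cmod (taylor_coeff f n))\<^sup>2 * r ^ (2 * n))) \<longlongrightarrow> B\<^sup>2 * (\<Sum>n<m. (cmod (taylor_coeff f n))\<^sup>2)) (at_left 1)"
      by simp
  qed simp
qed

text \<open>Abel summation (\<open>parts\<close>) writes a weighted sum as a combination of partial
  sums with coefficients \<open>w m\<close> and \<open>w k - w (Suc k)\<close>, which are
  nonnegative for a decreasing weight. This transfers estimates from the unweighted Hardy space to
  every such weight.\<close>

lemma sum_decreasing_weights_le:
  fixes w x y :: "nat \<Rightarrow> real"
  assumes "decseq w" "\<And>n. 0 \<le> w n" and le: "\<And>m. (\<Sum>n<m. x n) \<le> (\<Sum>n<m. y n)"
  shows "(\<Sum>n<m. w n * x n) \<le> (\<Sum>n<m. w n * y n)"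
proof -
  have parts: "(\<Sum>n<Suc m. w n * u n) = w m * (\<Sum>n<Suc m. u n) + (\<Sum>k<m. (w k - w (Suc k)) * (\<Sum>n<Suc k. u n))"
    for m and u :: "nat \<Rightarrow> real"
    by (induction m) (simp_all add: algebra_simps)
  show ?thesis
  proof (cases m)
    case (Suc k)
    have "w (Suc n) \<le> w n" for n using assms(1) by (simp add: decseq_Suc_iff)
    then show ?thesis
      unfolding Suc parts using assms(2) le 
      by (intro add_mono mult_left_mono[OF le] sum_mono) auto
  qed simp
qed

section \<open>Boundedness of multipliers\<close>

context function_inner_product_space
begin

lemma ip_norm_scale:
  assumes "f \<in> H"
  shows "ip_norm ip (\<lambda>x. c * f x) = cmod c * ip_norm ip f"
proof -
  have "ip (\<lambda>x. c * f x) (\<lambda>x. c * f x) = of_real ((cmod c)\<^sup>2) * ip f f"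
    unfolding complex_norm_square
    using assms by (simp add: ip_scale_left ip_scale_right scale_mem)
  then show ?thesis
    by (simp add: ip_norm_def real_sqrt_mult del: of_real_power)
qed

lemma cmod_ip_le:
  assumes f: "f \<in> H" and g: "g \<in> H"
  shows "cmod (ip f g) \<le> ip_norm ip f * ip_norm ip g"
proof (cases "ip f g = 0")
  case True
  then show ?thesis
    using f g by (simp add: ip_norm_def ip_nonneg)
next
  case False
  \<comment> \<open>The unimodular factor \<open>c\<close> turns \<open>ip f g\<close> into its
    modulus, so the bound for real parts applies.\<close>
  define c where "c = cnj (ip f g) / of_real (cmod (ip f g))"
  have "c * ip f g = of_real ((cmod (ip f g))\<^sup>2) / of_real (cmod (ip f g))"
    unfolding c_def complex_norm_square by simp
  then have "cmod (ip f g) = Re (ip (\<lambda>x. c * f x) g)"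
    using False by (simp add: ip_scale_left f g power2_eq_square)
  also have "\<dots> \<le> ip_norm ip (\<lambda>x. c * f x) * ip_norm ip g"
    by (intro Re_ip_le scale_mem f g)
  also have "ip_norm ip (\<lambda>x. c * f x) = ip_norm ip f"
    using False by (subst ip_norm_scale[OF f]) (simp add: c_def norm_divide)
  finally show ?thesis .
qed

lemma represented_continuous:
  assumes k: "k \<in> H" and rep: "\<And>f. f \<in> H \<Longrightarrow> f x = ip f k"
  shows "continuous_map mtopology euclidean (\<lambda>f. f x)"
proof -
  have "\<exists>r>0. mball f r \<subseteq> {g \<in> H. g x \<in> U}" if "open U" "f \<in> H" "f x \<in> U" for f U
  proof -
    obtain e where e: "e > 0" "ball (f x) e \<subseteq> U"
      using \<open>open U\<close> \<open>f x \<in> U\<close> by (rule openE)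
    \<comment> \<open>The summand 1 keeps the denominator positive when \<open>k\<close> has norm
      0.\<close>
    define r where "r = e / (ip_norm ip k + 1)"
    have k0: "0 \<le> ip_norm ip k" by (simp add: ip_norm_def ip_nonneg k)
    have "g x \<in> U" if g: "g \<in> H" "ip_dist H ip f g < r" for g
    proof (rule subsetD[OF e(2)])
      have "dist (g x) (f x) = cmod (f x - g x)" by (simp add: dist_norm norm_minus_commute)
      also have "f x - g x = ip (\<lambda>x. f x - g x) k"
        using rep[OF diff_mem[OF \<open>f \<in> H\<close> g(1)]] .
      also have "cmod \<dots> \<le> ip_dist H ip f g * ip_norm ip k"
        using cmod_ip_le[OF diff_mem[OF \<open>f \<in> H\<close> g(1)] k] \<open>f \<in> H\<close> g(1) by (simp add: ip_dist_def)
      also have "\<dots> \<le> r * ip_norm ip k"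
        using g(2) k0 by (intro mult_right_mono) auto
      also have "\<dots> < e"
        using e(1) k0 by (simp add: r_def field_simps)
      finally show "g x \<in> ball (f x) e" by (simp add: dist_commute)
    qed
    moreover have "r > 0" using e(1) k0 by (simp add: r_def)
    ultimately show ?thesis by (auto simp: mball_def)
  qed
  then show ?thesis
    by (auto simp: continuous_map_def openin_mtopology)
qed

end

text \<open>
  The functionals \<open>f \<mapsto> h x * f x / \<parallel>k\<^sub>x\<parallel>\<close> are pointwise bounded and have norm \<open>\<bar>h x\<bar>\<close>, so this is
  an instance of the uniform boundedness principle.
\<close>

lemma (in rkhs) multiplier_bounded:
  assumes rep: "\<And>x. x \<in> X \<Longrightarrow> \<exists>k\<in>H. \<forall>f\<in>H. f x = ip f k"
    and h: "h \<in> multipliers X H"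
  shows "bounded (h ` X)"
proof (cases "X = {}")
  case False
  obtain k where k: "\<And>x. x \<in> X \<Longrightarrow> k x \<in> H" "\<And>x f. x \<in> X \<Longrightarrow> f \<in> H \<Longrightarrow> f x = ip f (k x)"
    using rep by metis
  \<comment> \<open>By the reproducing property \<open>k x x\<close> is the squared norm of
    \<open>k x\<close>, and \<open>kernel_pos\<close> makes it nonzero, so division by this norm is
    legitimate below.\<close>
  have kx: "k x x = of_real ((ip_norm ip (k x))\<^sup>2)" "0 < ip_norm ip (k x)" if "x \<in> X" for x
  proof -
    have "reproducing_kernel H ip x x = k x x"
      unfolding reproducing_kernel_def by (subst kernel_element_eqI[of "k x"]) (auto simp: k that)
    then show "0 < ip_norm ip (k x)" "k x x = of_real ((ip_norm ip (k x))\<^sup>2)"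
      using kernel_pos[OF that] k(2)[OF that k(1)[OF that]]
      by (auto simp: ip_norm_def complex_eq_iff complex_is_Real_iff)
  qed
  \<comment> \<open>Membership of \<open>f\<close> in \<open>F N\<close> bounds all normalised
    functionals at \<open>f\<close> by \<open>N\<close>. These sets are closed by continuity of
    evaluation and exhaust \<open>H\<close> because \<open>h f\<close> is again in \<open>H\<close>,
    so Baire's theorem gives one of them interior points.\<close>
  define F where "F N = {f \<in> H. \<forall>x\<in>X. cmod (h x * f x) \<le> real N * ip_norm ip (k x)}" for N
  have "closedin mtopology (F N)" for N
  proof -
    have "F N = (\<Inter>x\<in>X. {f \<in> topspace mtopology. f x \<in> {y. cmod (h x * y) \<le> real N * ip_norm ip (k x)}})"
      using False by (auto simp: F_def)
    also have "closedin mtopology \<dots>"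
    proof (intro closedin_INT False)
      fix x assume "x \<in> X"
      have "closed {y. cmod (h x * y) \<le> real N * ip_norm ip (k x)}"
        by (intro closed_Collect_le continuous_intros)
      then show "closedin mtopology {f \<in> topspace mtopology. f x \<in> {y. cmod (h x * y) \<le> real N * ip_norm ip (k x)}}"
        by (intro closedin_continuous_map_preimage[OF continuous_eval[OF \<open>x \<in> X\<close>]]) simp
    qed
    finally show ?thesis .
  qed
  moreover have "\<Union>(range F) = H"
  proof -
    have "\<exists>N. f \<in> F N" if f: "f \<in> H" for f
    proof -
      have hf: "(\<lambda>x. h x * f x) \<in> H" using h f by (auto simp: multipliers_def)
      obtain N where "ip_norm ip (\<lambda>x. h x * f x) \<le> real N" using real_arch_simple by blast
      then have "cmod (h x * f x) \<le> real N * ip_norm ip (k x)" if "x \<in> X" for x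
        unfolding k(2)[OF that hf]
        by (rule order_trans[OF cmod_ip_le[OF hf k(1)[OF that]] mult_right_mono])
          (use kx(2)[OF that] in auto)
      then show ?thesis using f by (auto simp: F_def)
    qed
    then show ?thesis by (auto simp: F_def)
  qed
  ultimately obtain N where "mtopology interior_of (F N) \<noteq> {}"
    using metric_Baire_category_alt[OF complete, of "range F"] zero_mem interior_of_topspace[of mtopology]
    by auto
  then obtain f e where f: "f \<in> H" "e > 0" "mball f e \<subseteq> F N"
    by (auto simp: metric_interior_of)
  have "cmod (h x) \<le> 4 * real N / e" if x: "x \<in> X" for x
  proof -
    let ?n = "ip_norm ip (k x)"
    \<comment> \<open>The perturbation along \<open>k x\<close> has norm \<open>e / 2\<close>, so
      \<open>?g\<close> stays in the ball. Subtracting the values at \<open>f\<close> and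
      \<open>?g\<close> leaves \<open>h x * (e / 2 * ?n)\<close>, of modulus at most
      \<open>2 * N * ?n\<close>; hence the constant \<open>4 * N / e\<close>.\<close>
    let ?g = "\<lambda>y. f y + of_real (e / 2 / ?n) * k x y"
    have s: "(\<lambda>y. of_real (e / 2 / ?n) * k x y) \<in> H" by (rule scale_mem[OF k(1)[OF x]])
    have g: "?g \<in> H" by (rule add_mem[OF f(1) s])
    have "ip_dist H ip f ?g = ip_norm ip (\<lambda>y. - of_real (e / 2 / ?n) * k x y)"
      using f(1) g by (simp add: ip_dist_def)
    also have "\<dots> = e / 2"
      using kx(2)[OF x] f(2) by (subst ip_norm_scale[OF k(1)[OF x]]) (simp add: norm_divide norm_mult)
    finally have "?g \<in> F N" "f \<in> F N"
      using f g by (auto simp: subset_iff)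
    then have "cmod (h x * ?g x) \<le> real N * ?n" "cmod (h x * f x) \<le> real N * ?n"
      using x by (auto simp: F_def)
    then have "cmod (h x * ?g x - h x * f x) \<le> 2 * (real N * ?n)"
      using norm_triangle_ineq4[of "h x * ?g x" "h x * f x"] by linarith
    also have "h x * ?g x - h x * f x = h x * of_real (e / 2 * ?n)"
      using kx[OF x] by (simp add: algebra_simps power2_eq_square)
    finally have "cmod (h x) * (e / 2) * ?n \<le> (2 * real N) * ?n"
      using f(2) kx(2)[OF x] by (simp add: norm_mult norm_divide mult.assoc)
    then show ?thesis
      using f(2) kx(2)[OF x] by (simp add: field_simps)
  qed
  then show ?thesis by (auto intro!: boundedI)
qed simp

section \<open>Weighted Hardy spaces\<close>

definition weighted_hardy :: "(nat \<Rightarrow> real) \<Rightarrow> (complex \<Rightarrow> complex) set"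
  where "weighted_hardy w = {f. (\<forall>z. z \<notin> ball 0 1 \<longrightarrow> f z = 0) \<and> f holomorphic_on ball 0 1 \<and>
    summable (\<lambda>n. w n * (cmod (taylor_coeff f n))\<^sup>2)}"

definition weighted_ip :: "(nat \<Rightarrow> real) \<Rightarrow> (complex \<Rightarrow> complex) \<Rightarrow> (complex \<Rightarrow> complex) \<Rightarrow> complex"
  where "weighted_ip w f g = (\<Sum>n. of_real (w n) * taylor_coeff f n * cnj (taylor_coeff g n))"

text \<open>With \<open>r\<close> the squared modulus of a point \<open>x\<close> of the disk, the
  series in \<open>w_subexponential\<close> is the squared norm of the kernel element at
  \<open>x\<close>. It also makes the power series of every admissible coefficient sequence converge
  on the disk.\<close>

locale power_weight =
  fixes w :: "nat \<Rightarrow> real"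
  assumes w_pos: "0 < w n"
    and w_subexponential: "0 \<le> r \<Longrightarrow> r < 1 \<Longrightarrow> summable (\<lambda>n. r ^ n / w n)"
begin

lemma
  assumes "f \<in> weighted_hardy w"
  shows weighted_hardy_holomorphic: "f holomorphic_on ball 0 1"
    and weighted_hardy_summable: "summable (\<lambda>n. w n * (cmod (taylor_coeff f n))\<^sup>2)"
    and weighted_hardy_vanishes: "z \<notin> ball 0 1 \<Longrightarrow> f z = 0"
  using assms by (auto simp: weighted_hardy_def)

text \<open>By the inequality of arithmetic and geometric means, \<open>a n * z ^ n\<close> is
  dominated by \<open>w n * (cmod (a n))\<^sup>2\<close> plus the general term of the series in
  \<open>w_subexponential\<close>.\<close>

lemma weighted_hardy_series:
  assumes a: "summable (\<lambda>n. w n * (cmod (a n))\<^sup>2)"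
  obtains f where "f \<in> weighted_hardy w" "taylor_coeff f = a"
proof -
  define f where "f z = (if z \<in> ball 0 1 then \<Sum>n. a n * z ^ n else 0)" for z
  have "(\<lambda>n. a n * z ^ n) sums f z" if z: "z \<in> ball 0 1" for z
  proof -
    have "((cmod z)\<^sup>2) < 1" using z by (simp add: abs_square_less_1)
    then have "summable (\<lambda>n. w n * (cmod (a n))\<^sup>2 + ((cmod z)\<^sup>2) ^ n / w n)"
      by (intro summable_add a w_subexponential) auto
    moreover have "norm (a n * z ^ n) \<le> w n * (cmod (a n))\<^sup>2 + ((cmod z)\<^sup>2) ^ n / w n" for n
    proof -
      have "0 \<le> (sqrt (w n) * cmod (a n) - cmod z ^ n / sqrt (w n))\<^sup>2" by simp
      also have "\<dots> = w n * (cmod (a n))\<^sup>2 + ((cmod z)\<^sup>2) ^ n / w n - 2 * (cmod (a n) * cmod z ^ n)"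
        using w_pos[of n] by (simp add: power2_diff power_mult_distrib power_divide power_mult[symmetric] mult.commute)
      finally have "2 * (cmod (a n) * cmod z ^ n) \<le> w n * (cmod (a n))\<^sup>2 + ((cmod z)\<^sup>2) ^ n / w n"
        by simp
      moreover have "0 \<le> cmod (a n) * cmod z ^ n" by simp
      ultimately show ?thesis by (simp only: norm_mult norm_power)
    qed
    ultimately have "summable (\<lambda>n. a n * z ^ n)"
      by (rule summable_comparison_test'[where N=0])
    then show ?thesis using z by (simp add: f_def summable_sums)
  qed
  note * = power_series_taylor_coeff[OF this]
  have "f z = 0" if "z \<notin> ball 0 1" for z using that by (simp add: f_def)
  then show ?thesis
    using a * by (intro that[of f]) (simp_all add: weighted_hardy_def)
qed

lemma weighted_summable_add:
  assumes "summable (\<lambda>n. w n * (cmod (a n))\<^sup>2)" "summable (\<lambda>n. w n * (cmod (b n))\<^sup>2)"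
  shows "summable (\<lambda>n. w n * (cmod (a n + b n))\<^sup>2)"
proof (rule summable_comparison_test')
  show "summable (\<lambda>n. 2 * (w n * (cmod (a n))\<^sup>2) + 2 * (w n * (cmod (b n))\<^sup>2))"
    by (intro summable_add summable_mult assms)
  fix n
  have "(cmod (a n + b n))\<^sup>2 \<le> (cmod (a n) + cmod (b n))\<^sup>2"
    by (intro power_mono norm_triangle_ineq) auto
  also have "\<dots> \<le> 2 * (cmod (a n))\<^sup>2 + 2 * (cmod (b n))\<^sup>2"
    using sum_squares_bound[of "cmod (a n)" "cmod (b n)"] by (simp add: power2_sum)
  finally have le: "(cmod (a n + b n))\<^sup>2 \<le> 2 * (cmod (a n))\<^sup>2 + 2 * (cmod (b n))\<^sup>2" .
  show "norm (w n * (cmod (a n + b n))\<^sup>2) \<le> 2 * (w n * (cmod (a n))\<^sup>2) + 2 * (w n * (cmod (b n))\<^sup>2)"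
    using mult_left_mono[of _ _ "w n", OF le] w_pos[of n] by (simp add: abs_mult ring_distribs mult.left_commute)
qed

lemma weighted_ip_summable:
  assumes "f \<in> weighted_hardy w" "g \<in> weighted_hardy w"
  shows "summable (\<lambda>n. of_real (w n) * taylor_coeff f n * cnj (taylor_coeff g n))"
proof (rule summable_comparison_test')
  show "summable (\<lambda>n. w n * (cmod (taylor_coeff f n))\<^sup>2 + w n * (cmod (taylor_coeff g n))\<^sup>2)"
    by (intro summable_add weighted_hardy_summable assms)
  fix n
  let ?x = "cmod (taylor_coeff f n)" and ?y = "cmod (taylor_coeff g n)"
  have "?x * ?y \<le> ?x\<^sup>2 + ?y\<^sup>2"
    using sum_squares_bound[of ?x ?y] mult_nonneg_nonneg[OF norm_ge_zero norm_ge_zero, of "taylor_coeff f n" "taylor_coeff g n"] by linarith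
  then have "w n * (?x * ?y) \<le> w n * (?x\<^sup>2 + ?y\<^sup>2)"
    using w_pos[of n] by (intro mult_left_mono) auto
  then show "norm (of_real (w n) * taylor_coeff f n * cnj (taylor_coeff g n)) \<le> w n * ?x\<^sup>2 + w n * ?y\<^sup>2"
    using w_pos[of n] by (simp add: norm_mult ring_distribs mult.assoc)
qed

lemma weighted_ip_self:
  assumes "f \<in> weighted_hardy w"
  shows "weighted_ip w f f = of_real (\<Sum>n. w n * (cmod (taylor_coeff f n))\<^sup>2)"
proof -
  have "of_real (w n) * taylor_coeff f n * cnj (taylor_coeff f n) = of_real (w n * (cmod (taylor_coeff f n))\<^sup>2)" for n
    by (simp only: of_real_mult complex_norm_square mult.assoc)
  then show ?thesis
    unfolding weighted_ip_def by (simp only: suminf_of_real[OF weighted_hardy_summable[OF assms]])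
qed

sublocale function_inner_product_space "ball 0 1" "weighted_hardy w" "weighted_ip w"
proof
  show "f z = 0" if "f \<in> weighted_hardy w" "z \<notin> ball 0 1" for f z
    using that by (rule weighted_hardy_vanishes)
  have "taylor_coeff (\<lambda>x. 0) = (\<lambda>n. 0)"
    by (rule power_series_taylor_coeff) simp
  then show "(\<lambda>x. 0) \<in> weighted_hardy w"
    by (simp add: weighted_hardy_def)
next
  fix f g c assume f: "f \<in> weighted_hardy w"
  note hf = weighted_hardy_holomorphic[OF f]
  show "(\<lambda>x. c * f x) \<in> weighted_hardy w"
    using f hf weighted_hardy_summable[OF f, THEN summable_mult, of "(cmod c)\<^sup>2"]
    by (auto simp: weighted_hardy_def taylor_coeff_cmult norm_mult power_mult_distrib mult.left_commute
        intro!: holomorphic_intros)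
  show "weighted_ip w (\<lambda>x. c * f x) g = c * weighted_ip w f g" if g: "g \<in> weighted_hardy w"
    unfolding weighted_ip_def taylor_coeff_cmult[OF hf]
    by (subst suminf_mult[OF weighted_ip_summable[OF f g], symmetric]) (simp add: mult_ac)
  show "weighted_ip w g f = cnj (weighted_ip w f g)" if g: "g \<in> weighted_hardy w"
  proof -
    have "cnj (weighted_ip w f g) = (\<Sum>n. cnj (of_real (w n) * taylor_coeff f n * cnj (taylor_coeff g n)))"
      unfolding weighted_ip_def
      using weighted_ip_summable[OF f g] by (intro sums_unique) (simp only: sums_cnj summable_sums)
    then show ?thesis unfolding weighted_ip_def by (simp add: mult_ac)
  qed
  show "0 < Re (weighted_ip w f f)" if "f \<noteq> (\<lambda>x. 0)"
  proof -
    have "\<exists>n. taylor_coeff f n \<noteq> 0"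
    proof (rule ccontr)
      assume "\<not> ?thesis"
      then have "f z = 0" for z
        using taylor_coeff_sums[OF hf, of z] weighted_hardy_vanishes[OF f, of z] 
        by (cases "z \<in> ball 0 1") (auto dest: sums_unique)
      then show False using that by auto
    qed
    then obtain n where "taylor_coeff f n \<noteq> 0" ..
    then have "0 < w n * (cmod (taylor_coeff f n))\<^sup>2" using w_pos by simp
    then have "0 < (\<Sum>n. w n * (cmod (taylor_coeff f n))\<^sup>2)"
      by (intro suminf_pos2[OF weighted_hardy_summable[OF f]]) (auto simp: w_pos less_imp_le)
    then show ?thesis by (simp add: weighted_ip_self[OF f])
  qed
  show "(\<lambda>x. f x + g x) \<in> weighted_hardy w" if g: "g \<in> weighted_hardy w"
    using f g weighted_hardy_holomorphic[OF f] weighted_hardy_holomorphic[OF g] 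
      weighted_summable_add[OF weighted_hardy_summable[OF f] weighted_hardy_summable[OF g]]
    by (auto simp: weighted_hardy_def taylor_coeff_add intro!: holomorphic_intros)
  show "weighted_ip w (\<lambda>x. f x + g x) k = weighted_ip w f k + weighted_ip w g k"
    if g: "g \<in> weighted_hardy w" and k: "k \<in> weighted_hardy w" for k
    unfolding weighted_ip_def taylor_coeff_add[OF hf weighted_hardy_holomorphic[OF g]]
    by (simp add: ring_distribs suminf_add weighted_ip_summable f g k)
qed

text \<open>Pairing with these coefficients cancels \<open>w n\<close> and leaves the Taylor series
  of \<open>f\<close> at \<open>x\<close>.\<close>

lemma exists_kernel_element:
  assumes x: "x \<in> ball 0 1"
  obtains k where "k \<in> weighted_hardy w" "taylor_coeff k = (\<lambda>n. cnj x ^ n / of_real (w n))"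
    "\<And>f. f \<in> weighted_hardy w \<Longrightarrow> f x = weighted_ip w f k"
proof -
  let ?a = "\<lambda>n. cnj x ^ n / of_real (w n)"
  have "(cmod x)\<^sup>2 < 1" using x by (simp add: abs_square_less_1)
  then have "summable (\<lambda>n. ((cmod x)\<^sup>2) ^ n / w n)"
    by (intro w_subexponential) auto
  also have "(\<lambda>n. ((cmod x)\<^sup>2) ^ n / w n) = (\<lambda>n. w n * (cmod (?a n))\<^sup>2)"
    using w_pos by (auto simp: norm_divide norm_power power_divide power2_eq_square power_mult_distrib less_imp_neq)
  finally obtain k where k: "k \<in> weighted_hardy w" "taylor_coeff k = ?a"
    by (rule weighted_hardy_series)
  show ?thesis
  proof (rule that[OF k])
    fix f assume f: "f \<in> weighted_hardy w"
    have "of_real (w n) * taylor_coeff f n * cnj (?a n) = taylor_coeff f n * x ^ n" for n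
      using w_pos[of n] by simp
    then show "f x = weighted_ip w f k"
      using taylor_coeff_sums[OF weighted_hardy_holomorphic[OF f] x]
      by (simp add: weighted_ip_def k(2) sums_iff)
  qed
qed

section \<open>Completeness and the reproducing kernel\<close>

lemma taylor_coeff_diff_weighted_hardy:
  assumes "f \<in> weighted_hardy w" "g \<in> weighted_hardy w"
  shows "taylor_coeff (\<lambda>z. f z - g z) n = taylor_coeff f n - taylor_coeff g n"
  using assms by (intro taylor_coeff_diff weighted_hardy_holomorphic)

lemma weighted_dist_square:
  assumes "f \<in> weighted_hardy w" "g \<in> weighted_hardy w"
  shows "(ip_dist (weighted_hardy w) (weighted_ip w) f g)\<^sup>2
    = (\<Sum>n. w n * (cmod (taylor_coeff f n - taylor_coeff g n))\<^sup>2)"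
  using assms ip_nonneg[OF diff_mem[OF assms]]
  by (simp add: ip_dist_def ip_norm_def weighted_ip_self[OF diff_mem[OF assms]] taylor_coeff_diff_weighted_hardy)

lemma weighted_diff_summable:
  assumes "f \<in> weighted_hardy w" "g \<in> weighted_hardy w"
  shows "summable (\<lambda>n. w n * (cmod (taylor_coeff f n - taylor_coeff g n))\<^sup>2)"
  using weighted_hardy_summable[OF diff_mem[OF assms]] by (simp add: taylor_coeff_diff_weighted_hardy assms)

lemma weighted_hardy_complete: "mcomplete"
  unfolding mcomplete_def
proof (intro allI impI)
  fix s :: "nat \<Rightarrow> complex \<Rightarrow> complex"
  assume s: "MCauchy s"
  let ?d = "ip_dist (weighted_hardy w) (weighted_ip w)"
  have mem: "s n \<in> weighted_hardy w" for n using s by (auto simp: MCauchy_def)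
  have part: "(\<Sum>j<J. w j * (cmod (taylor_coeff (s n) j - taylor_coeff (s m) j))\<^sup>2) \<le> (?d (s n) (s m))\<^sup>2" for J n m
    unfolding weighted_dist_square[OF mem mem]
    by (rule sum_le_suminf[OF weighted_diff_summable[OF mem mem]]) (auto simp: w_pos less_imp_le)
  have "convergent (\<lambda>n. taylor_coeff (s n) j)" for j
  proof -
    have "Cauchy (\<lambda>n. taylor_coeff (s n) j)"
    proof (rule metric_CauchyI)
      fix e :: real assume "e > 0"
      then have "sqrt (w j) * e > 0" using w_pos by simp
      then obtain N where N: "\<And>n n'. N \<le> n \<Longrightarrow> N \<le> n' \<Longrightarrow> ?d (s n) (s n') < sqrt (w j) * e"
        using s unfolding MCauchy_def by meson
      have "dist (taylor_coeff (s m) j) (taylor_coeff (s n) j) < e" if "m \<ge> N" "n \<ge> N" for m n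
      proof -
        have "w j * (cmod (taylor_coeff (s m) j - taylor_coeff (s n) j))\<^sup>2
           \<le> (\<Sum>j<Suc j. w j * (cmod (taylor_coeff (s m) j - taylor_coeff (s n) j))\<^sup>2)"
          by (rule member_le_sum) (auto simp: w_pos less_imp_le)
        also have "\<dots> \<le> (?d (s m) (s n))\<^sup>2" by (rule part)
        also have "\<dots> < (sqrt (w j) * e)\<^sup>2"
          using N[OF that] by (intro power_strict_mono) auto
        also have "\<dots> = w j * e\<^sup>2" using w_pos[of j] by (simp add: power_mult_distrib)
        finally have "(cmod (taylor_coeff (s m) j - taylor_coeff (s n) j))\<^sup>2 < e\<^sup>2" using w_pos[of j] by simp
        then show ?thesis using \<open>e > 0\<close> by (simp add: dist_norm power_less_imp_less_base)
      qed
      then show "\<exists>M. \<forall>m\<ge>M. \<forall>n\<ge>M. dist (taylor_coeff (s m) j) (taylor_coeff (s n) j) < e" by blast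
    qed
    then show ?thesis by (rule Cauchy_convergent)
  qed
  then obtain a where a: "\<And>j. (\<lambda>n. taylor_coeff (s n) j) \<longlonglongrightarrow> a j"
    unfolding convergent_def by metis
  \<comment> \<open>The second index of the Cauchy estimate tends to infinity in each finite
    section; the resulting bound is uniform in \<open>J\<close> and so holds for the whole
    series.\<close>
  have near: "summable (\<lambda>j. w j * (cmod (taylor_coeff (s n) j - a j))\<^sup>2) \<and>
      (\<Sum>j. w j * (cmod (taylor_coeff (s n) j - a j))\<^sup>2) \<le> e\<^sup>2"
    if N: "\<And>m n. N \<le> m \<Longrightarrow> N \<le> n \<Longrightarrow> ?d (s m) (s n) < e" and n: "n \<ge> N" for N n e
  proof -
    have "(\<Sum>j<J. w j * (cmod (taylor_coeff (s n) j - a j))\<^sup>2) \<le> e\<^sup>2" for J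
    proof (rule tendsto_upperbound)
      show "(\<lambda>m. \<Sum>j<J. w j * (cmod (taylor_coeff (s n) j - taylor_coeff (s m) j))\<^sup>2)
        \<longlonglongrightarrow> (\<Sum>j<J. w j * (cmod (taylor_coeff (s n) j - a j))\<^sup>2)"
        by (intro tendsto_intros a)
      have "(\<Sum>j<J. w j * (cmod (taylor_coeff (s n) j - taylor_coeff (s m) j))\<^sup>2) \<le> e\<^sup>2" if "m \<ge> N" for m
        using part[of n m J] power_mono[OF less_imp_le[OF N[OF n that]], of 2] by force
      then show "\<forall>\<^sub>F m in sequentially. (\<Sum>j<J. w j * (cmod (taylor_coeff (s n) j - taylor_coeff (s m) j))\<^sup>2) \<le> e\<^sup>2"
        by (auto simp: eventually_sequentially)
    qed simp
    then show ?thesis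
      by (intro conjI summableI_nonneg_bounded[where x="e\<^sup>2"] suminf_le_const) (auto simp: w_pos less_imp_le)
  qed
  \<comment> \<open>Any fixed tolerance serves here: \<open>a\<close> differs from the coefficients
    of \<open>s N1\<close> by a weighted square-summable sequence, so \<open>a\<close> belongs to a
    member of the space.\<close>
  obtain N1 where "\<And>n n'. N1 \<le> n \<Longrightarrow> N1 \<le> n' \<Longrightarrow> ?d (s n) (s n') < 1"
    using s unfolding MCauchy_def by (meson zero_less_one)
  from near[OF this order_refl] have "summable (\<lambda>j. w j * (cmod (a j - taylor_coeff (s N1) j))\<^sup>2)"
    by (simp add: norm_minus_commute)
  from weighted_summable_add[OF this weighted_hardy_summable[OF mem[of N1]]]
  obtain l where l: "l \<in> weighted_hardy w" "taylor_coeff l = a"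
    by (auto elim: weighted_hardy_series)
  have "limitin mtopology s l sequentially"
    unfolding limitin_metric
  proof (intro conjI allI impI l(1))
    fix e :: real assume "e > 0"
    then have "e / 2 > 0" by simp
    then obtain N where N: "\<And>n n'. N \<le> n \<Longrightarrow> N \<le> n' \<Longrightarrow> ?d (s n) (s n') < e / 2"
      using s unfolding MCauchy_def by meson
    have "?d (s n) l < e" if "n \<ge> N" for n
    proof -
      have "(?d (s n) l)\<^sup>2 \<le> (e / 2)\<^sup>2"
        using near[OF N that] by (simp add: weighted_dist_square[OF mem l(1)] l(2))
      then have "?d (s n) l \<le> e / 2" by (rule power2_le_imp_le) (use \<open>e > 0\<close> in simp)
      then show ?thesis using \<open>e > 0\<close> by simp
    qed
    then show "\<forall>\<^sub>F n in sequentially. s n \<in> weighted_hardy w \<and> ?d (s n) l < e"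
      using mem by (auto simp: eventually_sequentially)
  qed
  then show "\<exists>x. limitin mtopology s x sequentially" by blast
qed

sublocale rkhs "ball 0 1" "weighted_hardy w" "weighted_ip w"
proof
  show "mcomplete" by (rule weighted_hardy_complete)
  fix x :: complex assume x: "x \<in> ball 0 1"
  obtain k where k: "k \<in> weighted_hardy w" "taylor_coeff k = (\<lambda>n. cnj x ^ n / of_real (w n))"
    "\<And>f. f \<in> weighted_hardy w \<Longrightarrow> f x = weighted_ip w f k"
    using exists_kernel_element[OF x] by metis
  show "continuous_map mtopology euclidean (\<lambda>f. f x)"
    by (rule represented_continuous[OF k(1,3)])
  \<comment> \<open>The coefficient of \<open>k\<close> at index 0 is \<open>1 / w 0\<close>, even
    for \<open>x = 0\<close>, so \<open>k\<close> is nonzero and has positive norm.\<close>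
  have "taylor_coeff (\<lambda>z. 0) = (\<lambda>n. 0)"
    by (rule power_series_taylor_coeff) simp
  moreover have "taylor_coeff k 0 \<noteq> 0"
    using w_pos[of 0] by (simp add: k(2))
  ultimately have "k \<noteq> (\<lambda>z. 0)" by auto
  then have "0 < Re (weighted_ip w k k)" by (rule ip_pos[OF k(1)])
  moreover have "weighted_ip w k k \<in> \<real>" by (simp add: weighted_ip_self[OF k(1)])
  moreover have "reproducing_kernel (weighted_hardy w) (weighted_ip w) x x = weighted_ip w k k"
    unfolding reproducing_kernel_def by (subst kernel_element_eqI[OF k(1,3)]) (use k(1,3) in auto)
  ultimately show "reproducing_kernel (weighted_hardy w) (weighted_ip w) x x \<in> \<real> \<and>
      0 < Re (reproducing_kernel (weighted_hardy w) (weighted_ip w) x x)"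
    by simp
qed

text \<open>At the point 0 only the coefficient \<open>1 / w 0\<close> of the kernel element
  survives, because \<open>0 ^ 0 = 1\<close>.\<close>

lemma weighted_hardy_kernel_normalized:
  assumes "w 0 = 1"
  shows "kernel_normalized_at (ball 0 1) (reproducing_kernel (weighted_hardy w) (weighted_ip w)) 0"
  unfolding kernel_normalized_at_def
proof (intro conjI ballI)
  fix x :: complex assume x: "x \<in> ball 0 1"
  obtain k where k: "k \<in> weighted_hardy w" "taylor_coeff k = (\<lambda>n. cnj 0 ^ n / of_real (w n))"
    "\<And>f. f \<in> weighted_hardy w \<Longrightarrow> f 0 = weighted_ip w f k"
    using exists_kernel_element[of 0] by auto
  have "(\<lambda>n. (if n = 0 then 1 else 0) * x ^ n) = (\<lambda>n. taylor_coeff k n * x ^ n)"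
    using assms by (auto simp: k(2) fun_eq_iff)
  moreover have "(\<lambda>n. (if n = 0 then 1 else 0) * x ^ n) sums 1"
    using sums_single[of 0 "\<lambda>n. x ^ n"] by (simp add: if_distrib[of "\<lambda>y. y * _"] cong: if_cong)
  ultimately have "k x = 1"
    using sums_unique2[OF taylor_coeff_sums[OF weighted_hardy_holomorphic[OF k(1)] x]] by simp
  then show "reproducing_kernel (weighted_hardy w) (weighted_ip w) x 0 = 1"
    unfolding reproducing_kernel_def by (subst kernel_element_eqI[OF k(1,3)]) auto
qed simp

section \<open>Multipliers and density of polynomials\<close>

lemma power_sum_mem: "power_sum m a \<in> weighted_hardy w"
proof -
  have "(\<lambda>n. w n * (cmod (taylor_coeff (power_sum m a) n))\<^sup>2) = (\<lambda>n. if n < m then w n * (cmod (a n))\<^sup>2 else 0)"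
    by (auto simp: taylor_coeff_power_sum)
  moreover have "summable \<dots>" by (rule summable_finite[of "{..<m}"]) auto
  ultimately show ?thesis
    using power_sum_holomorphic[of m a] by (auto simp: weighted_hardy_def power_sum_def)
qed

lemma indicator_mem: "indicator (ball 0 1) \<in> weighted_hardy w"
proof -
  have "indicator (ball 0 1) = power_sum 1 (\<lambda>n. 1)" by (auto simp: power_sum_def indicator_def)
  then show ?thesis by (simp only: power_sum_mem)
qed

lemma multipliers_subset: "multipliers (ball 0 1) (weighted_hardy w) \<subseteq> weighted_hardy w"
proof
  fix h assume h: "h \<in> multipliers (ball 0 1) (weighted_hardy w)"
  then have "(\<lambda>z. h z * indicator (ball 0 1) z) \<in> weighted_hardy w"
    using indicator_mem by (simp add: multipliers_def)
  also have "(\<lambda>z. h z * indicator (ball 0 1) z) = h"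
    using h by (auto simp: fun_eq_iff multipliers_def indicator_def)
  finally show "h \<in> weighted_hardy w" .
qed

text \<open>Multiplication by \<open>h\<close> enlarges unweighted partial sums of squares by at
  most the factor \<open>B\<^sup>2\<close>, and \<open>sum_decreasing_weights_le\<close> carries
  this over to \<open>w\<close>.\<close>

lemma H_infty_multiplier:
  assumes dec: "decseq w" and h: "h \<in> H_infty" and f: "f \<in> weighted_hardy w"
  shows "(\<lambda>z. h z * f z) \<in> weighted_hardy w"
proof -
  have hh: "h holomorphic_on ball 0 1" using h by (simp add: H_infty_def)
  note hf = weighted_hardy_holomorphic[OF f]
  obtain B where B: "\<And>z. z \<in> ball 0 1 \<Longrightarrow> cmod (h z) \<le> B"
    using h unfolding H_infty_def bounded_iff by blast
  let ?c = "taylor_coeff (\<lambda>z. h z * f z)"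
  have "summable (\<lambda>n. w n * (cmod (?c n))\<^sup>2)"
  proof (rule summableI_nonneg_bounded)
    fix m
    have "(\<Sum>n<m. w n * (cmod (?c n))\<^sup>2) \<le> (\<Sum>n<m. w n * (B\<^sup>2 * (cmod (taylor_coeff f n))\<^sup>2))"
      using taylor_coeff_bounded_mult[OF hh hf B]
      by (intro sum_decreasing_weights_le dec) (simp_all add: w_pos less_imp_le sum_distrib_left)
    also have "\<dots> = B\<^sup>2 * (\<Sum>n<m. w n * (cmod (taylor_coeff f n))\<^sup>2)"
      by (simp add: sum_distrib_left mult_ac)
    also have "\<dots> \<le> B\<^sup>2 * (\<Sum>n. w n * (cmod (taylor_coeff f n))\<^sup>2)"
      by (intro mult_left_mono sum_le_suminf weighted_hardy_summable f) (auto simp: w_pos less_imp_le)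
    finally show "(\<Sum>n<m. w n * (cmod (?c n))\<^sup>2) \<le> B\<^sup>2 * (\<Sum>n. w n * (cmod (taylor_coeff f n))\<^sup>2)" .
  qed (simp add: w_pos less_imp_le)
  then show ?thesis
    using hh hf weighted_hardy_vanishes[OF f] by (auto simp: weighted_hardy_def intro: holomorphic_on_mult)
qed

text \<open>Applied to the constant function 1, a multiplier is seen to be holomorphic; the uniform
  boundedness argument in \<open>multiplier_bounded\<close> shows that it is bounded.\<close>

lemma multipliers_weighted_hardy:
  assumes "decseq w"
  shows "multipliers (ball 0 1) (weighted_hardy w) = H_infty"
proof
  show "H_infty \<subseteq> multipliers (ball 0 1) (weighted_hardy w)"
    using H_infty_multiplier[OF assms] by (auto simp: multipliers_def) (simp add: H_infty_def)
  have "\<exists>k\<in>weighted_hardy w. \<forall>f\<in>weighted_hardy w. f x = weighted_ip w f k" if "x \<in> ball 0 1" for x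
    using exists_kernel_element[OF that] by metis
  note bounded = multiplier_bounded[OF this]
  show "multipliers (ball 0 1) (weighted_hardy w) \<subseteq> H_infty"
  proof
    fix h assume h: "h \<in> multipliers (ball 0 1) (weighted_hardy w)"
    then have "h \<in> weighted_hardy w" using multipliers_subset by blast
    then show "h \<in> H_infty"
      using bounded[OF _ h] weighted_hardy_vanishes[of h] weighted_hardy_holomorphic[of h]
      by (simp add: H_infty_def)
  qed
qed

lemma power_sum_H_infty: "power_sum m a \<in> H_infty"
proof -
  have "cmod (power_sum m a z) \<le> (\<Sum>n<m. cmod (a n))" if "z \<in> ball 0 1" for z
  proof -
    have "cmod (\<Sum>n<m. a n * z ^ n) \<le> (\<Sum>n<m. cmod (a n) * cmod z ^ n)"
      by (rule order_trans[OF norm_sum]) (simp add: norm_mult norm_power)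
    also have "\<dots> \<le> (\<Sum>n<m. cmod (a n) * 1)"
      using that by (intro sum_mono mult_left_mono power_le_one) auto
    finally show ?thesis using that by (simp add: power_sum_def)
  qed
  then have "bounded (power_sum m a ` ball 0 1)" by (auto intro!: boundedI)
  then show ?thesis
    using power_sum_holomorphic by (auto simp: H_infty_def power_sum_def)
qed

text \<open>Taylor polynomials of \<open>f\<close> are bounded on the disk, and their squared
  distance to \<open>f\<close> is a tail of the series for its squared norm.\<close>

lemma H_infty_dense:
  assumes "H_infty \<subseteq> weighted_hardy w"
  shows "mtopology closure_of H_infty = weighted_hardy w"
proof -
  have "\<exists>y\<in>H_infty. y \<in> mball f r" if f: "f \<in> weighted_hardy w" and r: "r > 0" for f r
  proof -
    let ?x = "\<lambda>n. w n * (cmod (taylor_coeff f n))\<^sup>2"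
    obtain N where N: "norm (\<Sum>i. ?x (i + N)) < r\<^sup>2"
      using suminf_exist_split[OF _ weighted_hardy_summable[OF f], of "r\<^sup>2"] r by auto
    let ?p = "power_sum N (taylor_coeff f)"
    have eq: "w n * (cmod (taylor_coeff f n - taylor_coeff ?p n))\<^sup>2 = (if n < N then 0 else ?x n)" for n
      by (simp add: taylor_coeff_power_sum)
    have "summable (\<lambda>n. if n < N then 0 else ?x n)"
      using weighted_diff_summable[OF f power_sum_mem[of N "taylor_coeff f"]] by (simp only: eq)
    then have "(ip_dist (weighted_hardy w) (weighted_ip w) f ?p)\<^sup>2 = (\<Sum>i. ?x (i + N))"
      unfolding weighted_dist_square[OF f power_sum_mem] eq
      by (subst suminf_split_initial_segment[of _ N]) auto
    then have "(ip_dist (weighted_hardy w) (weighted_ip w) f ?p)\<^sup>2 < r\<^sup>2"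
      using N by simp
    then have "ip_dist (weighted_hardy w) (weighted_ip w) f ?p < r"
      by (rule power_less_imp_less_base) (use r in simp)
    then show ?thesis
      using f power_sum_mem by (intro bexI[OF _ power_sum_H_infty]) (auto simp: mball_def)
  qed
  then show ?thesis by (auto simp: metric_closure_of)
qed

end

section \<open>A discontinuous functional\<close>

text \<open>The difference quotient \<open>g\<close> is bounded by compactness on the closed disk of
  radius 1/2 and by \<open>2 * B / (1/2)\<close> elsewhere, where \<open>B\<close> bounds
  \<open>h\<close>. Its value at 0 is chosen so that \<open>g\<close> is the power series with the
  coefficients of \<open>h\<close> shifted by one.\<close>

lemma H_infty_divide_coordinate:
  assumes h: "h \<in> H_infty"
  obtains g where "g \<in> H_infty" "h = (\<lambda>z. h 0 * indicator (ball 0 1) z + z * g z)"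
proof -
  have hh: "h holomorphic_on ball 0 1" using h by (simp add: H_infty_def)
  define g where "g z = (if z \<notin> ball 0 1 then 0 else if z = 0 then taylor_coeff h 1 else (h z - h 0) / z)" for z
  have h0: "taylor_coeff h 0 = h 0" by (simp add: taylor_coeff_def fps_expansion_def)
  have "(\<lambda>n. taylor_coeff h (Suc n) * z ^ n) sums g z" if z: "z \<in> ball 0 1" for z
  proof (cases "z = 0")
    case True
    then show ?thesis
      using sums_single[of 0 "\<lambda>n. taylor_coeff h (Suc n)"]
      by (simp add: g_def power_0_left if_distrib[of "\<lambda>y. _ * y"] cong: if_cong)
  next
    case False
    have "(\<lambda>n. taylor_coeff h (Suc n) * z ^ Suc n) sums (h z - h 0)"
      using taylor_coeff_sums[OF hh z] by (subst sums_Suc_iff) (simp add: h0)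
    then have "(\<lambda>n. taylor_coeff h (Suc n) * z ^ Suc n / z) sums ((h z - h 0) / z)"
      by (rule sums_divide)
    then show ?thesis using False z by (simp add: g_def)
  qed
  from power_series_taylor_coeff(1)[OF this] have hg: "g holomorphic_on ball 0 1" .
  obtain B where B: "\<And>z. z \<in> ball 0 1 \<Longrightarrow> cmod (h z) \<le> B"
    using h unfolding H_infty_def bounded_iff by blast
  have "bounded (g ` cball 0 (1/2))"
    by (intro compact_imp_bounded compact_continuous_image holomorphic_on_imp_continuous_on
        holomorphic_on_subset[OF hg]) auto
  then obtain C where C: "\<And>z. z \<in> cball 0 (1/2) \<Longrightarrow> cmod (g z) \<le> C"
    unfolding bounded_iff by blast
  have "cmod (g z) \<le> max C (4 * B)" if z: "z \<in> ball 0 1" for z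
  proof (cases "z \<in> cball 0 (1/2)")
    case False
    then have "cmod (g z) = cmod (h z - h 0) / cmod z" using z by (auto simp: g_def norm_divide)
    also have "\<dots> \<le> (2 * B) / (1/2)"
      using False B[OF z] B[of 0] norm_triangle_ineq4[of "h z" "h 0"] norm_ge_zero[of "h z"]
      by (intro frac_le) (auto simp del: norm_ge_zero)
    finally show ?thesis by simp
  qed (use C in force)
  then have "bounded (g ` ball 0 1)" by (auto intro!: boundedI)
  then have "g \<in> H_infty"
    using hg by (simp add: H_infty_def) (simp add: g_def)
  moreover have "h = (\<lambda>z. h 0 * indicator (ball 0 1) z + z * g z)"
    using h by (auto simp: fun_eq_iff g_def H_infty_def)
  ultimately show ?thesis by (rule that)
qed

text \<open>A basis of \<open>S\<close> stays independent when \<open>x\<close> is adjoined, so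
  values can be prescribed on it and extended linearly. The construction is purely algebraic and
  yields no continuity.\<close>

lemma (in vector_space) separating_linear_functional:
  assumes S: "subspace S" and x: "x \<notin> S"
  obtains g where "Vector_Spaces.linear scale (*) g" "\<And>y. y \<in> S \<Longrightarrow> g y = 0" "g x = 1"
proof -
  interpret vector_space_pair scale "(*)" ..
  obtain B where B: "B \<subseteq> S" "independent B" "S \<subseteq> span B"
    by (rule maximal_independent_subset)
  have "x \<notin> span B" using x span_minimal[OF B(1) S] by auto
  then have "independent (insert x B)" using B(2) by (rule independent_insertI)
  then obtain g where g: "Vector_Spaces.linear scale (*) g" "\<And>y. y \<in> insert x B \<Longrightarrow> g y = (if y = x then 1 else 0)"
    using linear_independent_extend[of "insert x B" "\<lambda>y. if y = x then 1 else 0"] by blast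
  have "g y = 0" if "y \<in> S" for y
  proof (rule linear_eq_0_on_span[OF g(1)])
    show "y \<in> span B" using that B(3) by auto
    show "g b = 0" if "b \<in> B" for b using g(2)[of b] that B(1) x by auto
  qed
  then show ?thesis using that[OF g(1)] g(2)[of x] by simp
qed

interpretation complex_functions: vector_space "\<lambda>c (f :: 'a \<Rightarrow> complex) x. c * f x"
  by unfold_locales (simp_all add: fun_eq_iff algebra_simps)

text \<open>
  The functional is a perturbation of the evaluation at 0 by a linear functional that vanishes on
  \<open>\<complex> + z H\<close>.  As \<open>H_infty \<subseteq> \<complex> + z H_infty\<close>, the perturbation is invisible on \<open>H_infty\<close>, and it is
  compatible with multiplication by \<open>h \<in> H_infty\<close> because \<open>h f - h 0 f \<in> z H\<close>.
\<close>

lemma (in power_weight) discontinuous_multiplicative_functional: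
  assumes dec: "decseq w" and f0: "f0 \<in> weighted_hardy w"
    and gap: "\<not> summable (\<lambda>n. w n * (cmod (taylor_coeff f0 (Suc n)))\<^sup>2)"
  obtains L where "linear_functional_on (weighted_hardy w) L" "L (indicator (ball 0 1)) = 1"
    "\<And>h f. h \<in> H_infty \<Longrightarrow> f \<in> weighted_hardy w \<Longrightarrow> L (\<lambda>z. h z * f z) = L h * L f"
    "\<not> continuous_map mtopology euclidean L"
proof -
  let ?H = "weighted_hardy w" and ?one = "indicator (ball 0 1) :: complex \<Rightarrow> complex"
  have sub: "H_infty \<subseteq> ?H"
    using multipliers_subset by (simp add: multipliers_weighted_hardy[OF dec])
  define S where "S = {\<lambda>z. c * ?one z + z * g z | c g. g \<in> ?H}"
  have SI: "(\<lambda>z. c * ?one z + z * g z) \<in> S" if "g \<in> ?H" for c g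
    using that by (auto simp: S_def)
  have "complex_functions.subspace S"
  proof (rule complex_functions.subspaceI)
    show "0 \<in> S" using SI[OF zero_mem, of 0] by (simp add: zero_fun_def)
  next
    fix f g assume "f \<in> S" "g \<in> S"
    then obtain c k d l where *: "k \<in> ?H" "l \<in> ?H" "f = (\<lambda>z. c * ?one z + z * k z)" "g = (\<lambda>z. d * ?one z + z * l z)"
      by (auto simp: S_def)
    show "f + g \<in> S"
      using SI[OF add_mem[OF *(1,2)], of "c + d"] by (simp add: *(3,4) plus_fun_def algebra_simps)
  next
    fix a f assume "f \<in> S"
    then obtain c k where *: "k \<in> ?H" "f = (\<lambda>z. c * ?one z + z * k z)"
      by (auto simp: S_def)
    show "(\<lambda>z. a * f z) \<in> S"
      using SI[OF scale_mem[OF *(1), of a], of "a * c"] by (simp add: *(2) algebra_simps)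
  qed
  \<comment> \<open>If \<open>f0\<close> were \<open>c + z g\<close>, the coefficients of
    \<open>g\<close> would be those of \<open>f0\<close> shifted by one, which \<open>gap\<close>
    excludes for a member of the space.\<close>
  moreover have "f0 \<notin> S"
  proof
    assume "f0 \<in> S"
    then obtain c g where g: "g \<in> ?H" "f0 = (\<lambda>z. c * ?one z + z * g z)" by (auto simp: S_def)
    have "taylor_coeff f0 = (\<lambda>n. case n of 0 \<Rightarrow> c | Suc n \<Rightarrow> taylor_coeff g n)"
    proof (rule power_series_taylor_coeff)
      fix z :: complex assume z: "z \<in> ball 0 1"
      have "(\<lambda>n. taylor_coeff g n * z ^ Suc n) sums (z * g z)"
        using sums_mult[OF taylor_coeff_sums[OF weighted_hardy_holomorphic[OF g(1)] z], of z] by (simp add: mult_ac)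
      then show "(\<lambda>n. (case n of 0 \<Rightarrow> c | Suc n \<Rightarrow> taylor_coeff g n) * z ^ n) sums f0 z"
        using z sums_Suc_iff[of "\<lambda>n. (case n of 0 \<Rightarrow> c | Suc n \<Rightarrow> taylor_coeff g n) * z ^ n" "z * g z"]
        by (simp add: g(2) add.commute)
    qed
    then show False using gap weighted_hardy_summable[OF g(1)] by simp
  qed
  ultimately obtain P where P: "Vector_Spaces.linear (\<lambda>c f z. c * f z) (*) P" "\<And>f. f \<in> S \<Longrightarrow> P f = 0" "P f0 = 1"
    by (rule complex_functions.separating_linear_functional) blast
  interpret P: Vector_Spaces.linear "\<lambda>c f z. c * f z" "(*)" P by (rule P(1))
  have P_add: "P (\<lambda>z. f z + g z) = P f + P g" for f g
    using P.add[of f g] by (simp add: plus_fun_def)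
  have P_scale: "P (\<lambda>z. c * f z) = c * P f" for c f
    by (rule P.scale)
  have P_H_infty: "P h = 0" if h: "h \<in> H_infty" for h
  proof -
    obtain g where g: "g \<in> H_infty" "h = (\<lambda>z. h 0 * ?one z + z * g z)"
      by (rule H_infty_divide_coordinate[OF h])
    show ?thesis by (subst g(2)) (use g(1) sub in \<open>auto intro!: P(2) SI\<close>)
  qed
  have P_mult: "P (\<lambda>z. h z * f z) = h 0 * P f" if h: "h \<in> H_infty" and f: "f \<in> ?H" for h f
  proof -
    obtain g where g: "g \<in> H_infty" "h = (\<lambda>z. h 0 * ?one z + z * g z)"
      by (rule H_infty_divide_coordinate[OF h])
    \<comment> \<open>The product \<open>g f\<close> lies in the space because \<open>g\<close> is a
      multiplier, so the second summand is in \<open>S\<close>; its term with factor 0 only gives it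
      the shape required by \<open>SI\<close>.\<close>
    have "h z * f z = h 0 * f z + (0 * ?one z + z * (g z * f z))" for z
      using fun_cong[OF g(2), of z] weighted_hardy_vanishes[OF f, of z]
      by (cases "z \<in> ball 0 1") (simp_all add: algebra_simps)
    then have "P (\<lambda>z. h z * f z) = h 0 * P f + P (\<lambda>z. 0 * ?one z + z * (g z * f z))"
      by (simp only: P_add P_scale)
    then show ?thesis
      using P(2)[OF SI[OF H_infty_multiplier[OF dec g(1) f], of 0]] by simp
  qed
  define L where "L f = f 0 + P f" for f
  show ?thesis
  proof (rule that[of L])
    show "linear_functional_on ?H L"
      by (simp add: linear_functional_on_def L_def P_add P_scale ring_distribs)
    have "?one = power_sum 1 (\<lambda>n. 1)" by (auto simp: power_sum_def indicator_def)
    then have "?one \<in> H_infty" by (simp only: power_sum_H_infty)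
    then show "L ?one = 1" by (simp add: L_def P_H_infty)
    show "L (\<lambda>z. h z * f z) = L h * L f" if "h \<in> H_infty" "f \<in> ?H" for h f
      using that by (simp add: L_def P_mult P_H_infty ring_distribs)
    show "\<not> continuous_map mtopology euclidean L"
    proof
      assume "continuous_map mtopology euclidean L"
      \<comment> \<open>For continuous \<open>L\<close> the zero set of \<open>P\<close> in the
        space would be closed. It contains the dense set \<open>H_infty\<close>, so \<open>P\<close>
        would vanish on the whole space, against \<open>P f0 = 1\<close>.\<close>
      then have "continuous_map mtopology euclidean (\<lambda>f. L f - f 0)"
        by (intro continuous_map_diff continuous_eval) auto
      then have "closedin mtopology {f \<in> topspace mtopology. L f - f 0 \<in> {0}}"
        by (rule closedin_continuous_map_preimage) simp
      moreover have "H_infty \<subseteq> {f \<in> topspace mtopology. L f - f 0 \<in> {0}}"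
        using sub by (auto simp: L_def P_H_infty)
      ultimately have "mtopology closure_of H_infty \<subseteq> {f \<in> topspace mtopology. L f - f 0 \<in> {0}}"
        by (intro closure_of_minimal)
      then have "?H \<subseteq> {f \<in> topspace mtopology. L f - f 0 \<in> {0}}"
        by (simp only: H_infty_dense[OF sub])
      then show False using f0 P(3) by (auto simp: L_def)
    qed
  qed
qed

section \<open>A weight with gaps\<close>

text \<open>On the block from \<open>2 ^ k\<close> to \<open>2 ^ Suc k - 1\<close> the exponent is
  \<open>k\<^sup>2\<close>, so the decay is roughly \<open>n\<close> to the power
  \<open>- log 2 n\<close>, while the step into the next block divides by
  \<open>2 ^ (2 * k + 1)\<close>. Since \<open>floor_log 0 = 0\<close>, the weight at 0 is
  1.\<close>

definition gap_weight :: "nat \<Rightarrow> real"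
  where "gap_weight n = (1/2) ^ (floor_log n)\<^sup>2"

lemma gap_weight_0: "gap_weight 0 = 1"
  by (simp add: gap_weight_def)

lemma decseq_gap_weight: "decseq gap_weight"
  unfolding gap_weight_def
  by (intro decseq_SucI power_decreasing power_mono floor_log_le_iff) auto

lemma gap_weight_power2: "gap_weight (2 ^ k) = (1/2) ^ k\<^sup>2"
  by (simp add: gap_weight_def)

lemma gap_weight_before_power2: "gap_weight (2 ^ Suc k - 1) = (1/2) ^ k\<^sup>2"
proof -
  have "1 \<le> (2::nat) ^ k" by simp
  then have "floor_log (2 ^ Suc k - 1) = k"
    unfolding power_Suc by (intro floor_log_eqI; linarith)
  then show ?thesis by (simp add: gap_weight_def)
qed

interpretation gap_weight: power_weight gap_weight
proof
  show "0 < gap_weight n" for n by (simp add: gap_weight_def)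
  fix r :: real assume r: "0 \<le> r" "r < 1"
  \<comment> \<open>Passing from \<open>r\<close> to \<open>s\<close> secures a positive base even
    for \<open>r = 0\<close>. With \<open>t\<close> the root of \<open>s\<close>, one factor
    \<open>t ^ n\<close> absorbs the inverse weight and the other remains as a geometric
    majorant.\<close>
  define s where "s = (1 + r) / 2"
  have s: "0 < s" "r \<le> s" "s < 1" using r by (auto simp: s_def)
  define t where "t = sqrt s"
  have t: "0 < t" "t < 1" "s = t * t" using s by (auto simp: t_def)
  \<comment> \<open>For \<open>n\<close> in the \<open>k\<close>-th block, \<open>t ^ n\<close> is
    at most \<open>t ^ (2 ^ k)\<close>, which is doubly exponentially small in \<open>k\<close> and
    beats \<open>2 ^ k\<^sup>2\<close>.\<close>
  have "eventually (\<lambda>k::nat. 2 powr (real k ^ 2) * t powr (2 powr real k) \<le> 1) at_top"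
    using t by real_asymp
  then obtain K where K: "\<And>k. k \<ge> K \<Longrightarrow> 2 powr (real k ^ 2) * t powr (2 powr real k) \<le> 1"
    by (auto simp: eventually_at_top_linorder)
  show "summable (\<lambda>n. r ^ n / gap_weight n)"
  proof (rule summable_comparison_test')
    show "summable (\<lambda>n. t ^ n)" using t by simp
    fix n :: nat assume n: "n \<ge> 2 ^ K"
    then have "n > 0" using less_le_trans[of 0 "2 ^ K" n] by simp
    let ?k = "floor_log n"
    have "K \<le> ?k" using floor_log_le_iff[OF n] by simp
    have "2 ^ ?k\<^sup>2 * t ^ n \<le> 2 ^ ?k\<^sup>2 * t ^ (2 ^ ?k)"
      using t floor_log_exp2_le[OF \<open>n > 0\<close>] by (intro mult_left_mono power_decreasing) auto
    also have "\<dots> = 2 powr (real ?k ^ 2) * t powr (2 powr real ?k)"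
      using t by (simp add: powr_realpow[symmetric])
    also have "\<dots> \<le> 1" by (rule K[OF \<open>K \<le> ?k\<close>])
    finally have *: "2 ^ ?k\<^sup>2 * t ^ n * t ^ n \<le> 1 * t ^ n"
      using t by (intro mult_right_mono) auto
    have "r ^ n \<le> t ^ n * t ^ n"
      using power_mono[of r s n] r s t by (simp add: power_mult_distrib)
    then have "2 ^ ?k\<^sup>2 * r ^ n \<le> 2 ^ ?k\<^sup>2 * (t ^ n * t ^ n)"
      by (rule mult_left_mono) simp
    also have "\<dots> \<le> t ^ n" using * by (simp add: mult.assoc)
    finally have "2 ^ ?k\<^sup>2 * r ^ n \<le> t ^ n" .
    then show "norm (r ^ n / gap_weight n) \<le> t ^ n"
      using r by (simp add: gap_weight_def power_one_over mult.commute)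
  qed
qed

text \<open>The coefficients sit at the block starts \<open>n = 2 ^ Suc k\<close>, with squared
  modulus \<open>1 / gap_weight (n - 1)\<close>. The terms of the squared norm are then
  \<open>gap_weight n / gap_weight (n - 1)\<close>, that is \<open>1 / 2 ^ (2 * k + 1)\<close>,
  whereas the shifted terms at \<open>n - 1\<close> all equal 1.\<close>

lemma gap_weight_gap:
  obtains f where "f \<in> weighted_hardy gap_weight"
    "\<not> summable (\<lambda>n. gap_weight n * (cmod (taylor_coeff f (Suc n)))\<^sup>2)"
proof -
  \<comment> \<open>The exponents start at 1, as the weight does not drop between 0 and
    \<open>2 ^ 0\<close>.\<close>
  let ?g = "\<lambda>k::nat. (2::nat) ^ Suc k"
  define a :: "nat \<Rightarrow> complex" where "a n = (if n \<in> range ?g then of_real (1 / sqrt (gap_weight (n - 1))) else 0)" for n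
  have a: "(cmod (a (?g k)))\<^sup>2 = 2 ^ k\<^sup>2" for k
    using gap_weight_before_power2[of k] by (simp add: a_def norm_divide power_divide power_one_over)
  have "gap_weight (?g k) * (cmod (a (?g k)))\<^sup>2 = (1/2) * (1/4) ^ k" for k
  proof -
    have "(Suc k)\<^sup>2 = 1 + 2 * k + k\<^sup>2" by (simp add: power2_eq_square)
    then have "gap_weight (?g k) = (1/2) * (1/4) ^ k * (1/2) ^ k\<^sup>2"
      by (simp only: gap_weight_power2 power_add power_mult) (simp add: power2_eq_square)
    then show ?thesis by (simp only: a) (simp add: power_one_over)
  qed
  moreover have "summable (\<lambda>k. (1/2) * (1/4) ^ k :: real)"
    by (intro summable_mult summable_geometric) auto
  ultimately have "summable (\<lambda>k. gap_weight (?g k) * (cmod (a (?g k)))\<^sup>2)" by (simp only:)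
  moreover have "strict_mono ?g" by (rule strict_monoI) simp
  ultimately have "summable (\<lambda>n. gap_weight n * (cmod (a n))\<^sup>2)"
    using summable_mono_reindex[of ?g "\<lambda>n. gap_weight n * (cmod (a n))\<^sup>2"] by (simp add: a_def)
  then obtain f where f: "f \<in> weighted_hardy gap_weight" "taylor_coeff f = a"
    by (rule gap_weight.weighted_hardy_series)
  have "\<not> summable (\<lambda>n. gap_weight n * (cmod (a (Suc n)))\<^sup>2)"
  proof
    assume "summable (\<lambda>n. gap_weight n * (cmod (a (Suc n)))\<^sup>2)"
    then have "(\<lambda>n. gap_weight n * (cmod (a (Suc n)))\<^sup>2) \<longlonglongrightarrow> 0" by (rule summable_LIMSEQ_zero)
    then obtain N where N: "\<And>n. n \<ge> N \<Longrightarrow> \<bar>gap_weight n * (cmod (a (Suc n)))\<^sup>2\<bar> < 1"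
      using LIMSEQ_D[of _ 0 1] by fastforce
    \<comment> \<open>The index \<open>?g N - 1\<close> is not below \<open>N\<close>, yet the term
      there is exactly 1.\<close>
    have "N \<le> ?g N - 1" using less_exp[of "Suc N"] by simp
    moreover have "Suc (?g N - 1) = ?g N" by simp
    ultimately have "\<bar>gap_weight (?g N - 1) * (cmod (a (?g N)))\<^sup>2\<bar> < 1" using N by metis
    then show False by (simp only: gap_weight_before_power2 a) (simp add: power_one_over)
  qed
  then show ?thesis using that f by simp
qed

theorem proposition5p2:
  shows "\<exists>(H :: (complex \<Rightarrow> complex) set)
      (ip :: (complex \<Rightarrow> complex) \<Rightarrow> (complex \<Rightarrow> complex) \<Rightarrow> complex)
      (\<Lambda> :: (complex \<Rightarrow> complex) \<Rightarrow> complex).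
    rkhs (ball 0 1) H ip \<and>
    (\<forall>f\<in>H. f holomorphic_on ball 0 1) \<and>
    linear_functional_on H \<Lambda> \<and>
    kernel_normalized_at (ball 0 1) (reproducing_kernel H ip) 0 \<and>
    multipliers (ball 0 1) H = H_infty \<and>
    (ip_topology H ip) closure_of (multipliers (ball 0 1) H) = H \<and>
    \<Lambda> (indicator (ball 0 1)) = 1 \<and>
    (\<forall>h\<in>multipliers (ball 0 1) H. \<forall>f\<in>H. \<Lambda> (\<lambda>z. h z * f z) = \<Lambda> h * \<Lambda> f) \<and>
    \<not> continuous_map (ip_topology H ip) euclidean \<Lambda>"
proof -
  obtain f0 where "f0 \<in> weighted_hardy gap_weight"
    "\<not> summable (\<lambda>n. gap_weight n * (cmod (taylor_coeff f0 (Suc n)))\<^sup>2)"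
    by (rule gap_weight_gap)
  then obtain L where L: "linear_functional_on (weighted_hardy gap_weight) L"
    "L (indicator (ball 0 1)) = 1"
    "\<And>h f. h \<in> H_infty \<Longrightarrow> f \<in> weighted_hardy gap_weight \<Longrightarrow> L (\<lambda>z. h z * f z) = L h * L f"
    "\<not> continuous_map (ip_topology (weighted_hardy gap_weight) (weighted_ip gap_weight)) euclidean L"
    by (rule gap_weight.discontinuous_multiplicative_functional[OF decseq_gap_weight]) blast
  have M: "multipliers (ball 0 1) (weighted_hardy gap_weight) = H_infty"
    by (rule gap_weight.multipliers_weighted_hardy[OF decseq_gap_weight])
  show ?thesis
  proof (intro exI conjI ballI)
    show "rkhs (ball 0 1) (weighted_hardy gap_weight) (weighted_ip gap_weight)"
      by (rule gap_weight.rkhs_axioms)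
    show "f holomorphic_on ball 0 1" if "f \<in> weighted_hardy gap_weight" for f
      using that by (rule gap_weight.weighted_hardy_holomorphic)
    show "kernel_normalized_at (ball 0 1)
        (reproducing_kernel (weighted_hardy gap_weight) (weighted_ip gap_weight)) 0"
      by (rule gap_weight.weighted_hardy_kernel_normalized[OF gap_weight_0])
    show "ip_topology (weighted_hardy gap_weight) (weighted_ip gap_weight)
        closure_of (multipliers (ball 0 1) (weighted_hardy gap_weight)) = weighted_hardy gap_weight"
      using gap_weight.H_infty_dense gap_weight.multipliers_subset by (simp only: M)
  qed (use L M in auto)
qed

end
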